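(* Let $\Omega\subset\mathbb{R}^n$ be open. Let $p:\overline\Omega\to[1,\infty)$ be log-H\"older continuous with $p^+<n$, let $0\le a(\cdot)\in L^\infty(\Omega)$, and let $r$ be a continuous bounded real function on $\Omega$. Let $\Phi(x,t):=t^{p(x)}+a(x)\,t^{p(x)}(\log(e+t))^{r(x)}$ and $$\Psi(x,t):=t^{p^*(x)}+(a(x))^{\frac{p^*(x)}{p(x)}}\,t^{p^*(x)}\Big(\log\Big(e+\frac{t}{a(x)^{(p(x)-1)/p(x)}}\Big)\Big)^{r(x)p^*(x)/p(x)},$$ where $\frac1{p^*(x)}=\frac1{p(x)}-\frac1n$. Suppose that $W^{1,\Phi(\cdot,\cdot)}(\Omega)\hookrightarrow L^{\Psi(\cdot,\cdot)}(\Omega)$ (continuous embedding). Then: (1) $\Omega$ satisfies the log-measure density condition when either $r(x)\ge0$ for all $x\in\Omega$, or $r(x)<0$ for some $x\in\Omega$ and $r(x)\ge0$ for some $x\in\Omega$; (2) $\Omega$ satisfies the measure density condition when $r(x)\le0$ for all $x\in\Omega$.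
   Context: $p^+:=\sup_\Omega p$. $p$ is log-H\"older continuous if there is $C$ with $|p(x)-p(y)|\le \frac{C}{\log(e+1/|x-y|)}$ for all $x,y\in\Omega$. Measure density condition: there is a constant $c>0$ such that $|B_R(x)\cap\Omega|\ge cR^n$ for every $x\in\overline\Omega$ and every $R\in(0,1/2]$. Log-measure density condition: there are constants $c>0$ and $\alpha>0$ such that $cR^n(\log(1/R))^{-\alpha}\le|B_R(x)\cap\Omega|$ for every $x\in\overline\Omega$ and every $R\in(0,1/2]$. At points where $a(x)=0$ the second summand of $\Psi$ is understood to be $0$. Musielak-Orlicz space: $\varrho_\Phi(u)=\int_\Omega\Phi(x,|u(x)|)\,dx$, $L^{\Phi(\cdot,\cdot)}(\Omega)=\{u \text{ measurable}: \varrho_\Phi(\lambda u)<\infty\text{ for some }\lambda>0\}$, with (quasi-)norm $\|u\|_{L^{\Phi(\cdot,\cdot)}(\Omega)}=\inf\{\lambda>0:\varrho_\Phi(u/\lambda)\le1\}$; similarly for $\Psi$. $W^{1,\Phi(\cdot,\cdot)}(\Omega)$ is the space of $u\in L^{\Phi(\cdot,\cdot)}(\Omega)$ whose weak first-order derivatives lie in $L^{\Phi(\cdot,\cdot)}(\Omega)$, with the Luxemburg (quasi-)norm of the modular $\sum_{|\alpha|\le1}\varrho_\Phi(\partial_\alpha u)$. *)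

theory Defs
  imports "HOL-Analysis.Analysis"
begin

section \<open>Exponents\<close>

definition log_Hoelder_on :: "'a::metric_space set \<Rightarrow> ('a \<Rightarrow> real) \<Rightarrow> bool" where
  "log_Hoelder_on \<Omega> p \<longleftrightarrow>
     (\<exists>C. \<forall>x\<in>\<Omega>. \<forall>y\<in>\<Omega>. \<bar>p x - p y\<bar> \<le> C / ln (exp 1 + 1 / dist x y))"

text \<open>The supremum is taken in the extended reals, so that \<open>exponent_sup \<Omega> p < n\<close> includes
  boundedness of \<open>p\<close> on \<open>\<Omega>\<close> (and holds when \<open>\<Omega>\<close> is empty).\<close>
definition exponent_sup :: "'a set \<Rightarrow> ('a \<Rightarrow> real) \<Rightarrow> ereal" where
  "exponent_sup \<Omega> p = (SUP x\<in>\<Omega>. ereal (p x))"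

definition sobolev_conj :: "('a::euclidean_space \<Rightarrow> real) \<Rightarrow> 'a \<Rightarrow> real" where
  "sobolev_conj p x = 1 / (1 / p x - 1 / real DIM('a))"

definition essentially_bounded_on :: "'a::euclidean_space set \<Rightarrow> ('a \<Rightarrow> real) \<Rightarrow> bool" where
  "essentially_bounded_on \<Omega> a \<longleftrightarrow>
     a \<in> borel_measurable (lebesgue_on \<Omega>) \<and> (\<exists>M. AE x in lebesgue_on \<Omega>. \<bar>a x\<bar> \<le> M)"


section \<open>Measure density conditions\<close>

definition measure_density :: "'a::euclidean_space set \<Rightarrow> bool" where
  "measure_density \<Omega> \<longleftrightarrow>
     (\<exists>c>0. \<forall>x\<in>closure \<Omega>. \<forall>R\<in>{0<..1/2}.
        c * R ^ DIM('a) \<le> measure lebesgue (ball x R \<inter> \<Omega>))"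

definition log_measure_density :: "'a::euclidean_space set \<Rightarrow> bool" where
  "log_measure_density \<Omega> \<longleftrightarrow>
     (\<exists>c>0. \<exists>\<alpha>>0. \<forall>x\<in>closure \<Omega>. \<forall>R\<in>{0<..1/2}.
        c * R ^ DIM('a) * ln (1 / R) powr (- \<alpha>) \<le> measure lebesgue (ball x R \<inter> \<Omega>))"


section \<open>Weak derivatives\<close>

fun Ck :: "nat \<Rightarrow> ('a::euclidean_space \<Rightarrow> real) \<Rightarrow> bool" where
  "Ck 0 f \<longleftrightarrow> continuous_on UNIV f"
| "Ck (Suc k) f \<longleftrightarrow>
     (\<forall>x. f differentiable at x) \<and> (\<forall>b\<in>Basis. Ck k (\<lambda>x. frechet_derivative f (at x) b))"

definition test_functions :: "'a::euclidean_space set \<Rightarrow> ('a \<Rightarrow> real) set" where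
  "test_functions \<Omega> =
     {\<phi>. (\<forall>k. Ck k \<phi>) \<and> compact (closure {x. \<phi> x \<noteq> 0}) \<and> closure {x. \<phi> x \<noteq> 0} \<subseteq> \<Omega>}"

definition locally_integrable_on :: "'a::euclidean_space set \<Rightarrow> ('a \<Rightarrow> real) \<Rightarrow> bool" where
  "locally_integrable_on \<Omega> u \<longleftrightarrow>
     (\<forall>K. compact K \<and> K \<subseteq> \<Omega> \<longrightarrow> set_integrable lebesgue K u)"

definition has_weak_partial ::
  "'a::euclidean_space set \<Rightarrow> 'a \<Rightarrow> ('a \<Rightarrow> real) \<Rightarrow> ('a \<Rightarrow> real) \<Rightarrow> bool" where
  "has_weak_partial \<Omega> b u v \<longleftrightarrow>
     locally_integrable_on \<Omega> u \<and> locally_integrable_on \<Omega> v \<and>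
     (\<forall>\<phi>\<in>test_functions \<Omega>.
        (LINT x:\<Omega>|lebesgue. u x * frechet_derivative \<phi> (at x) b)
        = - (LINT x:\<Omega>|lebesgue. v x * \<phi> x))"


section \<open>Musielak--Orlicz and Musielak--Orlicz--Sobolev spaces\<close>

definition modular ::
  "'a::euclidean_space set \<Rightarrow> ('a \<Rightarrow> real \<Rightarrow> real) \<Rightarrow> ('a \<Rightarrow> real) \<Rightarrow> ennreal" where
  "modular \<Omega> \<Phi> u = (\<integral>\<^sup>+x. ennreal (\<Phi> x \<bar>u x\<bar>) \<partial>lebesgue_on \<Omega>)"

definition MO_space ::
  "'a::euclidean_space set \<Rightarrow> ('a \<Rightarrow> real \<Rightarrow> real) \<Rightarrow> ('a \<Rightarrow> real) set" where
  "MO_space \<Omega> \<Phi> =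
     {u \<in> borel_measurable (lebesgue_on \<Omega>). \<exists>l>0. modular \<Omega> \<Phi> (\<lambda>x. l * u x) < \<infinity>}"

text \<open>The Luxemburg functional of a modular is extended-valued: it is \<open>\<infinity>\<close> if no \<open>l\<close> is admissible.\<close>
definition luxemburg :: "(('a \<Rightarrow> real) \<Rightarrow> ennreal) \<Rightarrow> ('a \<Rightarrow> real) \<Rightarrow> ennreal" where
  "luxemburg \<rho> u = (INF l\<in>{l::real. 0 < l \<and> \<rho> (\<lambda>x. u x / l) \<le> 1}. ennreal l)"

definition MO_norm ::
  "'a::euclidean_space set \<Rightarrow> ('a \<Rightarrow> real \<Rightarrow> real) \<Rightarrow> ('a \<Rightarrow> real) \<Rightarrow> ennreal" where
  "MO_norm \<Omega> \<Phi> = luxemburg (modular \<Omega> \<Phi>)"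

definition MO_sobolev_space ::
  "'a::euclidean_space set \<Rightarrow> ('a \<Rightarrow> real \<Rightarrow> real) \<Rightarrow> ('a \<Rightarrow> real) set" where
  "MO_sobolev_space \<Omega> \<Phi> =
     {u \<in> MO_space \<Omega> \<Phi>. \<forall>b\<in>Basis. \<exists>v\<in>MO_space \<Omega> \<Phi>. has_weak_partial \<Omega> b u v}"

text \<open>Weak derivatives are determined only up to null sets, which the modular does not see. So all
  members of the family below have the same value and the infimum merely avoids choosing a
  representative \<open>g b\<close> of the weak derivative in direction \<open>b\<close>.\<close>
definition sobolev_modular ::
  "'a::euclidean_space set \<Rightarrow> ('a \<Rightarrow> real \<Rightarrow> real) \<Rightarrow> ('a \<Rightarrow> real) \<Rightarrow> ennreal" where
  "sobolev_modular \<Omega> \<Phi> u =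
     (INF g\<in>{g. \<forall>b\<in>Basis. has_weak_partial \<Omega> b u (g b)}.
        modular \<Omega> \<Phi> u + (\<Sum>b\<in>Basis. modular \<Omega> \<Phi> (g b)))"

definition MO_sobolev_norm ::
  "'a::euclidean_space set \<Rightarrow> ('a \<Rightarrow> real \<Rightarrow> real) \<Rightarrow> ('a \<Rightarrow> real) \<Rightarrow> ennreal" where
  "MO_sobolev_norm \<Omega> \<Phi> = luxemburg (sobolev_modular \<Omega> \<Phi>)"

definition sobolev_embedding ::
  "'a::euclidean_space set \<Rightarrow> ('a \<Rightarrow> real \<Rightarrow> real) \<Rightarrow> ('a \<Rightarrow> real \<Rightarrow> real) \<Rightarrow> bool" where
  "sobolev_embedding \<Omega> \<Phi> \<Psi> \<longleftrightarrow>
     MO_sobolev_space \<Omega> \<Phi> \<subseteq> MO_space \<Omega> \<Psi> \<and>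
     (\<exists>C::real. \<forall>u\<in>MO_sobolev_space \<Omega> \<Phi>.
        MO_norm \<Omega> \<Psi> u \<le> ennreal C * MO_sobolev_norm \<Omega> \<Phi> u)"


section \<open>The generalized Orlicz functions\<close>

definition Phi_fun ::
  "('a \<Rightarrow> real) \<Rightarrow> ('a \<Rightarrow> real) \<Rightarrow> ('a \<Rightarrow> real) \<Rightarrow> 'a \<Rightarrow> real \<Rightarrow> real" where
  "Phi_fun p a r x t = t powr p x + a x * t powr p x * ln (exp 1 + t) powr r x"

definition Psi_fun ::
  "('a::euclidean_space \<Rightarrow> real) \<Rightarrow> ('a \<Rightarrow> real) \<Rightarrow> ('a \<Rightarrow> real) \<Rightarrow> 'a \<Rightarrow> real \<Rightarrow> real" where
  "Psi_fun p a r x t =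
     (let q = sobolev_conj p x in
       t powr q +
       (if a x = 0 then 0
        else a x powr (q / p x) * t powr q *
          ln (exp 1 + t / a x powr ((p x - 1) / p x)) powr (r x * q / p x)))"

end

theory Submission
  imports Defs
begin

text \<open>
  Two pointwise bounds carry all the information that is needed from the integrands:
  \<open>\<Psi>(x,t) \<ge> t\<^bsup>p*(x)\<^esup>\<close>, and \<open>\<Phi>(x,t) \<le> K t\<^bsup>p(x)\<^esup> ln(e + t)\<^bsup>s\<^esup>\<close> at almost every \<open>x\<close>,
  for every \<open>s \<ge> 0\<close> that bounds \<open>r\<close> from above.
  If \<open>r \<le> 0\<close>, then \<open>s = 0\<close> is possible, and this is what removes the logarithm from the conclusion.

  Write \<open>m(R) = |B\<^sub>R(z) \<inter> \<Omega>|\<close>. The embedding, tested on a \<open>C\<^sup>1\<close> bump that is supported in \<open>B\<^sub>R(z)\<close>, at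
  least \<open>1/2\<close> on \<open>B\<^bsub>R/2\<^esub>(z)\<close> and of gradient at most \<open>4/R\<close>, bounds \<open>m(R/2)\<close> by \<open>m(R)\<close>
  (\<open>embedding_on_balls\<close>). For a constant exponent \<open>p\<close> and \<open>s = 0\<close> the bound reads
  \<open>\<theta>(R/2) \<le> C \<theta>(R)\<^bsup>p*/p\<^esup>\<close> for the density \<open>\<theta>(R) = m(R) / R\<^sup>n\<close>. As \<open>p*/p > 1\<close>, a density below a
  small threshold \<open>\<delta>\<close> stays below it at all radii \<open>R / 2\<^sup>k\<close>. That is impossible for \<open>z \<in> \<Omega>\<close>: since
  \<open>\<Omega>\<close> is open, the density tends to the volume of the unit ball. Hence \<open>\<theta> > \<delta>\<close> at all small radii.

  Log-Hoelder continuity extends this to variable exponents: on \<open>B\<^sub>R(z)\<close> the exponents \<open>p\<close> and \<open>p*\<close>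
  oscillate by at most a multiple of \<open>1 / ln(1/R)\<close>, so powers of \<open>R\<close> change only by constant factors.
  For \<open>s > 0\<close> the threshold \<open>\<delta>\<close> is replaced by \<open>\<delta> ln(1/R)\<^bsup>-\<alpha>\<^esup>\<close> with \<open>\<alpha> = (n + 1) s\<close>; the
  superlinear gain then also absorbs the logarithm in the bound of \<open>\<Phi>\<close> (\<open>density_step\<close>).
  Finally, a ball centred at a point of the closure contains balls of comparable radius centred in
  \<open>\<Omega>\<close>.
\<close>

section \<open>Weak derivatives of continuously differentiable functions\<close>

text \<open>
  The difference quotients of \<open>f\<close> in direction \<open>b\<close> have integral \<open>0\<close> by translation invariance of the
  Lebesgue measure, and they converge to the directional derivative dominatedly.
\<close>
lemma integral_directional_derivative_eq_0:
  fixes f :: "'a::euclidean_space \<Rightarrow> real"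
  assumes deriv: "\<And>x. (f has_derivative f' x) (at x)"
    and cont: "continuous_on UNIV (\<lambda>x. f' x b)"
    and supp: "bounded {x. f x \<noteq> 0}"
  shows "(\<integral>x. f' x b \<partial>lborel) = 0"
proof -
  define h :: "nat \<Rightarrow> real" where "h n = 1 / real (Suc n)" for n
  define D where "D n x = (f (x + h n *\<^sub>R b) - f x) / h n" for n x
  have h: "0 < h n" "h n \<le> 1" for n
    by (auto simp: h_def)
  have h_lim: "h \<longlonglongrightarrow> 0"
    unfolding h_def by (rule LIMSEQ_Suc[OF lim_1_over_n])
  obtain r where r: "\<And>x. f x \<noteq> 0 \<Longrightarrow> norm x \<le> r"
    using supp by (auto simp: bounded_iff)
  have f_cont: "continuous_on UNIV f"
    by (intro continuous_at_imp_continuous_on ballI has_derivative_continuous[OF deriv])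
  then have f_meas [measurable]: "f \<in> borel_measurable borel"
    by (rule borel_measurable_continuous_onI)
  have f_int: "integrable lborel f"
  proof -
    have "integrable lborel (\<lambda>x. indicator (cball 0 r) x *\<^sub>R f x)"
      by (rule borel_integrable_compact) (auto intro: continuous_on_subset[OF f_cont])
    moreover have "(\<lambda>x. indicator (cball 0 r) x *\<^sub>R f x) = f"
      using r by (force simp: fun_eq_iff indicator_def)
    ultimately show ?thesis by simp
  qed
  have transl: "integrable lborel (\<lambda>x. f (x + c))" "(\<integral>x. f (x + c) \<partial>lborel) = (\<integral>x. f x \<partial>lborel)" for c
  proof -
    have eq: "lborel = distr lborel borel ((+) c)"
      by (simp add: lborel_distr_plus)
    have "integrable (distr lborel borel ((+) c)) f"
      using f_int eq by simp
    then show "integrable lborel (\<lambda>x. f (x + c))"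
      by (subst (asm) integrable_distr_eq) (auto simp: add.commute)
    have "(\<integral>x. f x \<partial>lborel) = (\<integral>x. f x \<partial>distr lborel borel ((+) c))"
      using eq by simp
    also have "\<dots> = (\<integral>x. f (x + c) \<partial>lborel)"
      by (subst integral_distr) (auto simp: add.commute)
    finally show "(\<integral>x. f (x + c) \<partial>lborel) = (\<integral>x. f x \<partial>lborel)" ..
  qed
  have D_int: "(\<integral>x. D n x \<partial>lborel) = 0" for n
    unfolding D_def using transl f_int by simp
  have "compact ((\<lambda>x. f' x b) ` cball 0 (r + 2 * norm b))"
    by (intro compact_continuous_image continuous_on_subset[OF cont]) auto
  then have "bounded ((\<lambda>x. f' x b) ` cball 0 (r + 2 * norm b))"
    by (rule compact_imp_bounded)
  then obtain M where M: "\<And>x. norm x \<le> r + 2 * norm b \<Longrightarrow> \<bar>f' x b\<bar> \<le> M"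
    by (fastforce simp: bounded_iff)
  \<comment> \<open>The mean value theorem bounds the quotients by the derivative; step lengths are at most \<open>1\<close>, so all
    quotients vanish off one common ball.\<close>
  have D_le: "\<bar>D n x\<bar> \<le> indicator (cball 0 (r + norm b)) x * M" for n x
  proof (cases "norm x \<le> r + norm b")
    case True
    have "\<exists>t::real. 0 < t \<and> t < h n \<and>
        f (x + h n *\<^sub>R b) - f (x + 0 *\<^sub>R b) = (h n - 0) * f' (x + t *\<^sub>R b) b"
    proof (rule MVT2)
      fix t :: real
      have "((\<lambda>t. f (x + t *\<^sub>R b)) has_derivative (\<lambda>s. f' (x + t *\<^sub>R b) (s *\<^sub>R b))) (at t)"
        by (rule has_derivative_compose[OF _ deriv]) (auto intro!: derivative_eq_intros)
      moreover have "(\<lambda>s. f' (x + t *\<^sub>R b) (s *\<^sub>R b)) = (*) (f' (x + t *\<^sub>R b) b)"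
        using has_derivative_linear[OF deriv[of "x + t *\<^sub>R b"]]
        by (auto simp: linear_cmul mult.commute)
      ultimately show "((\<lambda>t. f (x + t *\<^sub>R b)) has_real_derivative f' (x + t *\<^sub>R b) b) (at t)"
        by (simp add: has_field_derivative_def)
    qed (use h in auto)
    then obtain t where t: "0 < t" "t < h n" "f (x + h n *\<^sub>R b) - f x = h n * f' (x + t *\<^sub>R b) b"
      by auto
    have "D n x = f' (x + t *\<^sub>R b) b"
      using t h[of n] by (simp add: D_def)
    moreover have "norm (x + t *\<^sub>R b) \<le> r + 2 * norm b"
    proof -
      have "norm (t *\<^sub>R b) \<le> 1 * norm b"
        unfolding norm_scaleR using t h[of n] by (intro mult_right_mono) auto
      then show ?thesis
        using True norm_triangle_ineq[of x "t *\<^sub>R b"] by linarith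
    qed
    ultimately show ?thesis
      using M True by simp
  next
    case False
    have "norm (h n *\<^sub>R b) \<le> 1 * norm b"
      unfolding norm_scaleR using h[of n] by (intro mult_right_mono) auto
    then have "r < norm (x + h n *\<^sub>R b)"
      using False norm_diff_ineq[of x "h n *\<^sub>R b"] by linarith
    moreover have "r < norm x"
      using False norm_ge_zero[of b] by linarith
    ultimately have "f (x + h n *\<^sub>R b) = 0" "f x = 0"
      using r by force+
    then show ?thesis
      using False by (simp add: D_def)
  qed
  have D_lim: "(\<lambda>n. D n x) \<longlonglongrightarrow> f' x b" for x
  proof -
    have "((\<lambda>t. f (x + t *\<^sub>R b)) has_derivative (\<lambda>s. f' (x + 0 *\<^sub>R b) (s *\<^sub>R b))) (at 0)"
      by (rule has_derivative_compose[OF _ deriv]) (auto intro!: derivative_eq_intros)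
    moreover have "(\<lambda>s. f' (x + 0 *\<^sub>R b) (s *\<^sub>R b)) = (*) (f' x b)"
      using has_derivative_linear[OF deriv[of x]] by (auto simp: linear_cmul mult.commute)
    ultimately have "((\<lambda>t. f (x + t *\<^sub>R b)) has_real_derivative f' x b) (at 0)"
      by (simp add: has_field_derivative_def)
    then have "((\<lambda>t. (f (x + t *\<^sub>R b) - f x) / t) \<longlongrightarrow> f' x b) (at 0)"
      by (simp add: DERIV_def)
    moreover have "filterlim h (at 0) sequentially"
      using h_lim h by (auto simp: filterlim_at less_imp_neq[THEN not_sym])
    ultimately show ?thesis
      unfolding D_def by (rule filterlim_compose)
  qed
  have "(\<lambda>n. \<integral>x. D n x \<partial>lborel) \<longlonglongrightarrow> (\<integral>x. f' x b \<partial>lborel)"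
  proof (rule integral_dominated_convergence)
    show "(\<lambda>x. f' x b) \<in> borel_measurable lborel"
      using cont by (simp add: borel_measurable_continuous_onI)
    show "D n \<in> borel_measurable lborel" for n
      unfolding D_def by measurable
    show "integrable lborel (\<lambda>x. indicator (cball 0 (r + norm b)) x * M)"
      using borel_integrable_compact[OF compact_cball continuous_on_const, of 0 "r + norm b" M]
      by (simp only: real_scaleR_def)
  qed (use D_le D_lim in auto)
  then show ?thesis
    using D_int by (simp add: LIMSEQ_const_iff)
qed

lemma continuous_imp_locally_integrable:
  fixes u :: "'a::euclidean_space \<Rightarrow> real"
  assumes "continuous_on UNIV u"
  shows "locally_integrable_on \<Omega> u"
  unfolding locally_integrable_on_def set_integrable_def
proof (intro allI impI)
  fix K :: "'a set" assume K: "compact K \<and> K \<subseteq> \<Omega>"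
  have "integrable lborel (\<lambda>x. indicator K x *\<^sub>R u x)"
    using K assms by (intro borel_integrable_compact) (auto intro: continuous_on_subset)
  moreover have "(\<lambda>x. indicator K x *\<^sub>R u x) \<in> borel_measurable lborel"
    using calculation by auto
  ultimately show "integrable lebesgue (\<lambda>x. indicator K x *\<^sub>R u x)"
    by (subst integrable_completion)
qed

text \<open>
  Integration by parts: the product of \<open>u\<close> and a test function has bounded support, so the integral of
  its derivative vanishes.
\<close>
lemma has_weak_partial_of_C1:
  fixes u :: "'a::euclidean_space \<Rightarrow> real"
  assumes deriv: "\<And>x. (u has_derivative u' x) (at x)"
    and cont: "continuous_on UNIV (\<lambda>x. u' x b)" and b: "b \<in> Basis"
  shows "has_weak_partial \<Omega> b u (\<lambda>x. u' x b)"
  unfolding has_weak_partial_def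
proof (intro conjI ballI)
  have u_cont: "continuous_on UNIV u"
    by (intro continuous_at_imp_continuous_on ballI has_derivative_continuous[OF deriv])
  then show "locally_integrable_on \<Omega> u"
    by (rule continuous_imp_locally_integrable)
  show "locally_integrable_on \<Omega> (\<lambda>x. u' x b)"
    using cont by (rule continuous_imp_locally_integrable)
  fix \<phi> assume "\<phi> \<in> test_functions \<Omega>"
  then have Ck: "Ck (Suc 0) \<phi>" and comp: "compact (closure {x. \<phi> x \<noteq> 0})"
    and sub: "closure {x. \<phi> x \<noteq> 0} \<subseteq> \<Omega>"
    unfolding test_functions_def by blast+
  obtain S where S: "compact S" "S \<subseteq> \<Omega>" "{x. \<phi> x \<noteq> 0} \<subseteq> S"
    using comp sub closure_subset by metis
  define \<phi>' where "\<phi>' x = frechet_derivative \<phi> (at x)" for x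
  have d\<phi>: "(\<phi> has_derivative \<phi>' x) (at x)" for x
    using Ck unfolding \<phi>'_def by (auto simp: frechet_derivative_works)
  have c\<phi>': "continuous_on UNIV (\<lambda>x. \<phi>' x b)"
    using Ck b unfolding \<phi>'_def by auto
  have c\<phi>: "continuous_on UNIV \<phi>"
    by (intro continuous_at_imp_continuous_on ballI has_derivative_continuous[OF d\<phi>])
  have out: "\<phi> x = 0" "\<phi>' x b = 0" if "x \<notin> S" for x
  proof -
    show "\<phi> x = 0"
      using that S(3) by blast
    have "(\<phi> has_derivative (\<lambda>_. 0)) (at x)"
    proof (rule has_derivative_transform_within_open[where f="\<lambda>_. 0"])
      show "open (- S)"
        using S(1) by (simp add: compact_imp_closed open_Compl)
      show "0 = \<phi> y" if "y \<in> - S" for y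
        using that S(3) by force
    qed (use that in auto)
    then show "\<phi>' x b = 0"
      using has_derivative_unique[OF d\<phi>] by metis
  qed
  have int: "integrable lborel (\<lambda>x. g x)"
    if "continuous_on UNIV g" "\<And>x. x \<notin> S \<Longrightarrow> g x = 0" for g :: "'a \<Rightarrow> real"
  proof -
    have "integrable lborel (\<lambda>x. indicator (S) x *\<^sub>R g x)"
      by (intro borel_integrable_compact S(1) continuous_on_subset[OF that(1)]) auto
    moreover have "(\<lambda>x. indicator (S) x *\<^sub>R g x) = g"
      using that(2) by (force simp: fun_eq_iff indicator_def)
    ultimately show ?thesis by simp
  qed
  have int1: "integrable lborel (\<lambda>x. u x * \<phi>' x b)"
    using out by (intro int continuous_intros u_cont c\<phi>') auto
  have int2: "integrable lborel (\<lambda>x. u' x b * \<phi> x)"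
    using out by (intro int continuous_intros cont c\<phi>) auto
  have "(\<integral>x. (\<lambda>h. u x * \<phi>' x h + u' x h * \<phi> x) b \<partial>lborel) = 0"
  proof (rule integral_directional_derivative_eq_0)
    show "((\<lambda>x. u x * \<phi> x) has_derivative (\<lambda>h. u x * \<phi>' x h + u' x h * \<phi> x)) (at x)" for x
      by (rule has_derivative_mult[OF deriv d\<phi>])
    show "continuous_on UNIV (\<lambda>x. u x * \<phi>' x b + u' x b * \<phi> x)"
      by (intro continuous_intros u_cont c\<phi>' cont c\<phi>)
    show "bounded {x. u x * \<phi> x \<noteq> 0}"
      by (rule bounded_subset[OF compact_imp_bounded[OF S(1)]]) (use S(3) in auto)
  qed
  then have sum0: "(\<integral>x. u x * \<phi>' x b \<partial>lborel) = - (\<integral>x. u' x b * \<phi> x \<partial>lborel)"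
    using int1 int2 by simp
  have drop: "(LINT x:\<Omega>|lebesgue. g x) = (\<integral>x. g x \<partial>lborel)"
    if "integrable lborel g" "\<And>x. x \<notin> S \<Longrightarrow> g x = 0" for g :: "'a \<Rightarrow> real"
  proof -
    have "(\<lambda>x. indicator \<Omega> x *\<^sub>R g x) = g"
      using that(2) S(2) by (force simp: fun_eq_iff indicator_def)
    then show ?thesis
      using that(1) by (simp add: set_lebesgue_integral_def integral_completion)
  qed
  show "(LINT x:\<Omega>|lebesgue. u x * frechet_derivative \<phi> (at x) b) = - (LINT x:\<Omega>|lebesgue. u' x b * \<phi> x)"
    using drop[OF int1] drop[OF int2] sum0 out unfolding \<phi>'_def by simp
qed

section \<open>A continuously differentiable bump on a ball\<close>

lemma has_real_derivative_pos_part_square: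
  "((\<lambda>t::real. (max 0 t)\<^sup>2) has_real_derivative 2 * max 0 t) (at t)"
  unfolding has_field_derivative_def
proof (rule has_derivativeI_sandwich[where e=1 and H="\<lambda>y. \<bar>y - t\<bar>"])
  show "((\<lambda>y. \<bar>y - t\<bar>) \<longlongrightarrow> 0) (at t)"
    using tendsto_rabs[OF tendsto_diff[OF tendsto_ident_at[of t UNIV] tendsto_const[of t]]] by simp
  fix y :: real assume "y \<noteq> t"
  have "\<bar>(max 0 y)\<^sup>2 - (max 0 t)\<^sup>2 - 2 * max 0 t * (y - t)\<bar> \<le> (y - t)\<^sup>2"
  proof (cases "0 \<le> y"; cases "0 \<le> t")
    assume "0 \<le> y" "\<not> 0 \<le> t"
    then have "y\<^sup>2 \<le> (y - t)\<^sup>2" by (intro power_mono) auto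
    then show ?thesis using \<open>0 \<le> y\<close> \<open>\<not> 0 \<le> t\<close> by (simp add: max_def)
  next
    assume *: "\<not> 0 \<le> y" "0 \<le> t"
    then have "0 \<le> (- y) * t" by (intro mult_nonneg_nonneg) auto
    moreover have "0 \<le> y\<^sup>2" "0 \<le> t\<^sup>2" by simp_all
    moreover have "(max 0 y)\<^sup>2 - (max 0 t)\<^sup>2 - 2 * max 0 t * (y - t) = t\<^sup>2 - 2 * (y * t)"
      using * by (simp add: max_def power2_eq_square algebra_simps)
    moreover have "(y - t)\<^sup>2 = y\<^sup>2 - 2 * (y * t) + t\<^sup>2"
      by (simp add: power2_diff)
    moreover have "(- y) * t = - (y * t)"
      by simp
    ultimately show ?thesis by linarith
  qed (use zero_le_power2[of "y - t"] in \<open>auto simp: max_def power2_eq_square algebra_simps abs_if\<close>)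
  then show "norm ((max 0 y)\<^sup>2 - (max 0 t)\<^sup>2 - 2 * max 0 t * (y - t)) / norm (y - t) \<le> \<bar>y - t\<bar>"
    using \<open>y \<noteq> t\<close> by (simp add: divide_le_eq power2_eq_square abs_mult[symmetric])
qed (auto intro: bounded_linear_mult_right)

text \<open>
  Squaring the positive part makes the function \<open>C\<^sup>1\<close> across the sphere of radius \<open>R\<close>, so that its
  classical derivative is a weak derivative in every open set, whatever the shape of \<open>\<Omega>\<close>.
\<close>
definition bump :: "'a::euclidean_space \<Rightarrow> real \<Rightarrow> 'a \<Rightarrow> real" where
  "bump z R x = (max 0 (1 - (norm (x - z))\<^sup>2 / R\<^sup>2))\<^sup>2"

definition bump_deriv :: "'a::euclidean_space \<Rightarrow> real \<Rightarrow> 'a \<Rightarrow> 'a \<Rightarrow> real" where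
  "bump_deriv z R x h = - 4 * max 0 (1 - (norm (x - z))\<^sup>2 / R\<^sup>2) * ((x - z) \<bullet> h) / R\<^sup>2"

lemma bump_has_derivative: "(bump z R has_derivative bump_deriv z R x) (at x)"
proof -
  have "((\<lambda>x. 1 - (norm (x - z))\<^sup>2 / R\<^sup>2) has_derivative (\<lambda>h. - (2 * ((x - z) \<bullet> h) / R\<^sup>2))) (at x)"
    unfolding power2_norm_eq_inner divide_inverse
    by (auto intro!: derivative_eq_intros simp: inner_commute algebra_simps)
  from has_derivative_compose[OF this has_real_derivative_pos_part_square[unfolded has_field_derivative_def]]
  show ?thesis
    unfolding bump_def bump_deriv_def by (simp add: mult.assoc mult.left_commute)
qed

lemma continuous_on_bump_deriv: "continuous_on UNIV (\<lambda>x. bump_deriv z R x b)"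
  unfolding bump_deriv_def divide_inverse by (intro continuous_intros)

lemma bump_outside:
  assumes "R > 0" "x \<notin> ball z R" shows "bump z R x = 0" "bump_deriv z R x h = 0"
proof -
  have "R \<le> norm (x - z)" using assms by (simp add: dist_norm norm_minus_commute)
  then have "R\<^sup>2 \<le> (norm (x - z))\<^sup>2" using assms by (intro power_mono) auto
  then have "1 - (norm (x - z))\<^sup>2 / R\<^sup>2 \<le> 0" using assms by (simp add: field_simps)
  then have "max 0 (1 - (norm (x - z))\<^sup>2 / R\<^sup>2) = 0" by simp
  then show "bump z R x = 0" "bump_deriv z R x h = 0" by (simp_all add: bump_def bump_deriv_def)
qed

lemma bump_bounds:
  assumes "R > 0" shows "0 \<le> bump z R x" "bump z R x \<le> 1"
proof -
  have "max 0 (1 - (norm (x - z))\<^sup>2 / R\<^sup>2) \<le> 1" by simp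
  then have "(max 0 (1 - (norm (x - z))\<^sup>2 / R\<^sup>2))\<^sup>2 \<le> 1\<^sup>2" by (intro power_mono) auto
  then show "0 \<le> bump z R x" "bump z R x \<le> 1"
    by (simp_all add: bump_def)
qed

lemma bump_deriv_bound:
  assumes "R > 0" "b \<in> Basis" shows "\<bar>bump_deriv z R x b\<bar> \<le> 4 / R"
proof (cases "x \<in> ball z R")
  case True
  have "\<bar>(x - z) \<bullet> b\<bar> \<le> norm (x - z)"
    using assms by (simp add: Basis_le_norm)
  also have "\<dots> \<le> R"
    using True by (simp add: dist_norm norm_minus_commute)
  finally have 1: "\<bar>(x - z) \<bullet> b\<bar> \<le> R" .
  have 2: "\<bar>max 0 (1 - (norm (x - z))\<^sup>2 / R\<^sup>2)\<bar> \<le> 1" by simp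
  have "\<bar>bump_deriv z R x b\<bar> = 4 * (\<bar>max 0 (1 - (norm (x - z))\<^sup>2 / R\<^sup>2)\<bar> * \<bar>(x - z) \<bullet> b\<bar>) / R\<^sup>2"
    by (simp add: bump_deriv_def abs_mult abs_divide)
  also have "\<dots> \<le> 4 * (1 * R) / R\<^sup>2"
    using 1 2 assms by (intro divide_right_mono mult_left_mono mult_mono) auto
  finally show ?thesis using assms by (simp add: power2_eq_square)
qed (use assms bump_outside(2)[of R x z b] in auto)

lemma bump_ge_half:
  assumes "R > 0" "x \<in> ball z (R / 2)" shows "1 / 2 \<le> bump z R x"
proof -
  have "norm (x - z) \<le> R / 2" using assms by (simp add: dist_norm norm_minus_commute)
  then have "(norm (x - z))\<^sup>2 \<le> (R / 2)\<^sup>2" by (intro power_mono) auto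
  then have "3 / 4 \<le> 1 - (norm (x - z))\<^sup>2 / R\<^sup>2" using assms by (simp add: field_simps)
  then have "(3 / 4)\<^sup>2 \<le> bump z R x" unfolding bump_def by (intro power_mono le_max_iff_disj[THEN iffD2] disjI2) simp_all
  then show ?thesis by (simp add: power2_eq_square)
qed

section \<open>The embedding tested on bumps\<close>

lemma nn_integral_const_on_ball:
  fixes \<Omega> :: "'a::euclidean_space set"
  assumes "open \<Omega>" "0 \<le> H"
  shows "(\<integral>\<^sup>+x. ennreal H * indicator (ball z R) x \<partial>lebesgue_on \<Omega>)
    = ennreal (H * measure lebesgue (ball z R \<inter> \<Omega>))"
proof -
  have \<Omega>_sets: "\<Omega> \<inter> space lebesgue \<in> sets lebesgue"
    using \<open>open \<Omega>\<close> by simp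
  have fm: "ball z R \<inter> \<Omega> \<in> lmeasurable"
    using \<open>open \<Omega>\<close> by (intro bounded_set_imp_lmeasurable) (auto intro: bounded_subset[OF bounded_ball])
  have "(\<integral>\<^sup>+x. ennreal H * indicator (ball z R) x \<partial>lebesgue_on \<Omega>)
      = (\<integral>\<^sup>+x. ennreal H * indicator (ball z R \<inter> \<Omega>) x \<partial>lebesgue)"
    by (subst nn_integral_restrict_space[OF \<Omega>_sets]) (auto intro!: nn_integral_cong simp: indicator_def)
  also have "\<dots> = ennreal H * emeasure lebesgue (ball z R \<inter> \<Omega>)"
    using fm by (intro nn_integral_cmult_indicator) auto
  also have "\<dots> = ennreal (H * measure lebesgue (ball z R \<inter> \<Omega>))"
    using fm \<open>0 \<le> H\<close> by (simp add: emeasure_eq_measure2 ennreal_mult)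
  finally show ?thesis .
qed

text \<open>
  The bump \<open>u\<close> is scaled by \<open>\<Lambda> = 4 / (R T)\<close>, so that \<open>u / \<Lambda>\<close> and its partial derivatives are bounded by
  \<open>T\<close>. If \<open>\<Phi>\<close> is at most \<open>H\<close> on such values, the \<open>n + 1\<close> summands of the Sobolev modular of \<open>u / \<Lambda>\<close> are
  at most \<open>H m(R)\<close> each, and smallness of \<open>H m(R)\<close> gives the Sobolev norm bound \<open>\<Lambda>\<close>. The embedding turns it
  into an estimate of the \<open>\<Psi>\<close>-modular, which is bounded below on the half ball, where \<open>u \<ge> 1/2\<close>.
  Stated with a free level \<open>T\<close>, the estimate avoids inverting \<open>\<Phi>\<close> or \<open>\<Psi>\<close>.
\<close>
lemma embedding_on_balls:
  fixes \<Omega> :: "'a::euclidean_space set" and q :: "'a \<Rightarrow> real"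
  assumes "open \<Omega>" and emb: "sobolev_embedding \<Omega> \<Phi> \<Psi>"
    and \<Phi>0: "\<And>x. \<Phi> x 0 = 0"
    and \<Psi>: "\<And>x t. 0 \<le> t \<Longrightarrow> t powr q x \<le> \<Psi> x t"
    and q: "\<And>x. x \<in> \<Omega> \<Longrightarrow> 0 \<le> q x"
  obtains C where "1 \<le> C"
    and "\<And>z R T H. 0 < R \<Longrightarrow> R \<le> 1 \<Longrightarrow> 0 < T \<Longrightarrow> 0 \<le> H \<Longrightarrow>
      (AE x in lebesgue_on \<Omega>. x \<in> ball z R \<longrightarrow> (\<forall>t\<in>{0..T}. \<Phi> x t \<le> H)) \<Longrightarrow>
      H * (real DIM('a) + 1) * measure lebesgue (ball z R \<inter> \<Omega>) \<le> 1 \<Longrightarrow>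
      (\<integral>\<^sup>+x\<in>ball z (R / 2). ennreal ((R * T / C) powr q x) \<partial>lebesgue_on \<Omega>) \<le> 1"
proof -
  obtain C0 where C0: "\<And>u. u \<in> MO_sobolev_space \<Omega> \<Phi> \<Longrightarrow> MO_norm \<Omega> \<Psi> u \<le> ennreal C0 * MO_sobolev_norm \<Omega> \<Phi> u"
    using emb unfolding sobolev_embedding_def by blast
  define C1 where "C1 = max 1 C0"
  have C1: "1 \<le> C1" "C0 \<le> C1" by (auto simp: C1_def)
  have "(\<integral>\<^sup>+x\<in>ball z (R / 2). ennreal ((R * T / (16 * C1)) powr q x) \<partial>lebesgue_on \<Omega>) \<le> 1"
    if R: "0 < R" "R \<le> 1" and T: "0 < T" and H: "0 \<le> H"
      and \<Phi>H: "AE x in lebesgue_on \<Omega>. x \<in> ball z R \<longrightarrow> (\<forall>t\<in>{0..T}. \<Phi> x t \<le> H)"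
      and small: "H * (real DIM('a) + 1) * measure lebesgue (ball z R \<inter> \<Omega>) \<le> 1" for z R T H
  proof -
    define m where "m = measure lebesgue (ball z R \<inter> \<Omega>)"
    define \<Lambda> where "\<Lambda> = 4 / (R * T)"
    have \<Lambda>: "0 < \<Lambda>" using R T by (simp add: \<Lambda>_def)
    have \<Omega>_sets: "\<Omega> \<inter> space lebesgue \<in> sets lebesgue"
      using \<open>open \<Omega>\<close> by simp
    have mod_le: "modular \<Omega> \<Phi> f \<le> ennreal (H * m)"
      if "\<And>x. \<bar>f x\<bar> \<le> T" "\<And>x. x \<notin> ball z R \<Longrightarrow> f x = 0" for f
    proof -
      have "modular \<Omega> \<Phi> f \<le> (\<integral>\<^sup>+x. ennreal H * indicator (ball z R) x \<partial>lebesgue_on \<Omega>)"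
        unfolding modular_def
      proof (rule nn_integral_mono_AE)
        show "AE x in lebesgue_on \<Omega>. ennreal (\<Phi> x \<bar>f x\<bar>) \<le> ennreal H * indicator (ball z R) x"
          using \<Phi>H
        proof eventually_elim
          case (elim x)
          then show ?case
            using that[of x] by (cases "x \<in> ball z R") (auto simp: \<Phi>0 intro!: ennreal_leI)
        qed
      qed
      also have "\<dots> = ennreal (H * m)"
        unfolding m_def by (rule nn_integral_const_on_ball[OF \<open>open \<Omega>\<close> H])
      finally show ?thesis .
    qed
    define u where "u = bump z R"
    define v where "v b x = bump_deriv z R x b" for b x
    have u_le: "\<bar>u x / \<Lambda>\<bar> \<le> T" for x
    proof -
      have "\<bar>u x / \<Lambda>\<bar> \<le> 1 / \<Lambda>"
        using bump_bounds[OF R(1), of z x] \<Lambda> by (simp add: u_def divide_right_mono)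
      also have "\<dots> = R * T / 4" by (simp add: \<Lambda>_def)
      also have "\<dots> \<le> 1 * T / 1" using R T by (intro frac_le mult_right_mono) auto
      finally show ?thesis by simp
    qed
    have v_le: "\<bar>v b x / \<Lambda>\<bar> \<le> T" if "b \<in> Basis" for b x
    proof -
      have "\<bar>v b x / \<Lambda>\<bar> \<le> (4 / R) / \<Lambda>"
        using divide_right_mono[OF bump_deriv_bound[OF R(1) that, of z x], of \<Lambda>] \<Lambda> by (simp add: v_def)
      also have "\<dots> = T" using R by (simp add: \<Lambda>_def)
      finally show ?thesis .
    qed
    have mod_u: "modular \<Omega> \<Phi> (\<lambda>x. u x / \<Lambda>) \<le> ennreal (H * m)"
      using u_le bump_outside(1)[OF R(1)] by (intro mod_le) (auto simp: u_def)
    have mod_v: "modular \<Omega> \<Phi> (\<lambda>x. v b x / \<Lambda>) \<le> ennreal (H * m)" if "b \<in> Basis" for b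
      using v_le[OF that] bump_outside(2)[OF R(1)] by (intro mod_le) (auto simp: v_def)
    have weak: "has_weak_partial \<Omega> b u (v b)"
      and weak_scaled: "has_weak_partial \<Omega> b (\<lambda>x. u x / \<Lambda>) (\<lambda>x. v b x / \<Lambda>)" if "b \<in> Basis" for b
    proof -
      show "has_weak_partial \<Omega> b u (v b)"
        unfolding u_def v_def
        by (rule has_weak_partial_of_C1[OF bump_has_derivative continuous_on_bump_deriv that])
      show "has_weak_partial \<Omega> b (\<lambda>x. u x / \<Lambda>) (\<lambda>x. v b x / \<Lambda>)"
        unfolding u_def v_def
      proof (rule has_weak_partial_of_C1[OF _ _ that])
        show "((\<lambda>x. bump z R x / \<Lambda>) has_derivative (\<lambda>h. bump_deriv z R x h / \<Lambda>)) (at x)" for x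
          using has_derivative_mult_left[OF bump_has_derivative, of z R "1 / \<Lambda>" x] by simp
        show "continuous_on UNIV (\<lambda>x. bump_deriv z R x b / \<Lambda>)"
          using \<Lambda> by (intro continuous_intros continuous_on_bump_deriv) auto
      qed
    qed
    have meas: "f \<in> borel_measurable (lebesgue_on \<Omega>)" if "continuous_on UNIV f" for f :: "'a \<Rightarrow> real"
      using that \<Omega>_sets by (intro continuous_imp_measurable_on_sets_lebesgue) (auto intro: continuous_on_subset)
    have MO: "f \<in> MO_space \<Omega> \<Phi>" if "continuous_on UNIV f" "modular \<Omega> \<Phi> (\<lambda>x. f x / \<Lambda>) \<le> ennreal (H * m)" for f
      unfolding MO_space_def
    proof (intro CollectI conjI exI)
      show "f \<in> borel_measurable (lebesgue_on \<Omega>)" using meas that by blast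
      show "0 < 1 / \<Lambda>" using \<Lambda> by simp
      show "modular \<Omega> \<Phi> (\<lambda>x. 1 / \<Lambda> * f x) < \<infinity>"
        using that(2) by (simp add: order_le_less_trans[OF _ ennreal_less_top])
    qed
    have u_cont: "continuous_on UNIV u"
      unfolding u_def by (intro continuous_at_imp_continuous_on ballI has_derivative_continuous[OF bump_has_derivative])
    have u_in: "u \<in> MO_sobolev_space \<Omega> \<Phi>"
      unfolding MO_sobolev_space_def
      using MO[OF u_cont mod_u] MO[OF _ mod_v] weak continuous_on_bump_deriv[of z R]
      by (auto simp: v_def[abs_def])
    have "sobolev_modular \<Omega> \<Phi> (\<lambda>x. u x / \<Lambda>)
        \<le> modular \<Omega> \<Phi> (\<lambda>x. u x / \<Lambda>) + (\<Sum>b\<in>Basis. modular \<Omega> \<Phi> (\<lambda>x. v b x / \<Lambda>))"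
      unfolding sobolev_modular_def using weak_scaled by (intro INF_lower) auto
    also have "\<dots> \<le> ennreal (H * m) + (\<Sum>b\<in>(Basis::'a set). ennreal (H * m))"
      by (intro add_mono sum_mono mod_u mod_v)
    also have "\<dots> = ennreal (H * m + (\<Sum>b\<in>(Basis::'a set). H * m))"
      using H by (subst sum_ennreal) (auto simp: m_def ennreal_plus)
    also have "H * m + (\<Sum>b\<in>(Basis::'a set). H * m) = H * (real DIM('a) + 1) * m"
      by (simp add: algebra_simps)
    also have "ennreal (H * (real DIM('a) + 1) * m) \<le> ennreal 1"
      using small by (intro ennreal_leI) (simp add: m_def)
    finally have "sobolev_modular \<Omega> \<Phi> (\<lambda>x. u x / \<Lambda>) \<le> 1" by simp
    then have norm_u: "MO_sobolev_norm \<Omega> \<Phi> u \<le> ennreal \<Lambda>"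
      unfolding MO_sobolev_norm_def luxemburg_def using \<Lambda> by (intro INF_lower) auto
    \<comment> \<open>The Luxemburg functional is an infimum that need not be attained: the factor \<open>2\<close> makes room for
      an admissible \<open>l\<close>.\<close>
    have "MO_norm \<Omega> \<Psi> u \<le> ennreal C0 * MO_sobolev_norm \<Omega> \<Phi> u"
      by (rule C0[OF u_in])
    also have "\<dots> \<le> ennreal C1 * ennreal \<Lambda>"
      using C1 norm_u by (intro mult_mono ennreal_leI) auto
    also have "\<dots> = ennreal (C1 * \<Lambda>)"
      using C1 \<Lambda> by (simp add: ennreal_mult)
    also have "\<dots> < ennreal (2 * C1 * \<Lambda>)"
      using C1 \<Lambda> by (intro ennreal_lessI) auto
    finally obtain l where l: "0 < l" "modular \<Omega> \<Psi> (\<lambda>x. u x / l) \<le> 1" "ennreal l < ennreal (2 * C1 * \<Lambda>)"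
      unfolding MO_norm_def luxemburg_def by (auto simp: INF_less_iff)
    then have l': "l < 2 * C1 * \<Lambda>"
      by (simp add: ennreal_less_iff)
    have "(\<integral>\<^sup>+x\<in>ball z (R / 2). ennreal ((R * T / (16 * C1)) powr q x) \<partial>lebesgue_on \<Omega>)
        \<le> modular \<Omega> \<Psi> (\<lambda>x. u x / l)"
      unfolding modular_def
    proof (rule nn_integral_mono)
      fix x assume "x \<in> space (lebesgue_on \<Omega>)"
      then have x: "x \<in> \<Omega>" by (simp add: space_restrict_space)
      show "ennreal ((R * T / (16 * C1)) powr q x) * indicator (ball z (R / 2)) x \<le> ennreal (\<Psi> x \<bar>u x / l\<bar>)"
      proof (cases "x \<in> ball z (R / 2)")
        case True
        have "R * T / (16 * C1) = (1 / 2) / (2 * C1 * \<Lambda>)"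
          using R T C1 by (simp add: \<Lambda>_def field_simps)
        also have "\<dots> \<le> u x / l"
          using bump_ge_half[OF R(1) True] l l' by (intro frac_le) (auto simp: u_def)
        finally have "R * T / (16 * C1) \<le> \<bar>u x / l\<bar>" by linarith
        then have "(R * T / (16 * C1)) powr q x \<le> \<bar>u x / l\<bar> powr q x"
          using q[OF x] R T C1 by (intro powr_mono2) auto
        also have "\<dots> \<le> \<Psi> x \<bar>u x / l\<bar>" by (rule \<Psi>) simp
        finally show ?thesis using True by (simp add: ennreal_leI)
      qed simp
    qed
    also have "\<dots> \<le> 1" by (rule l)
    finally show ?thesis .
  qed
  moreover have "1 \<le> 16 * C1" using C1 by simp
  ultimately show ?thesis using that by blast
qed

section \<open>Oscillation of the exponents\<close>

text \<open>
  For \<open>L = ln(1/R)\<close> the hypotheses say that \<open>T\<close> is at most a fixed power of \<open>1/R\<close> and that \<open>\<omega>\<close> is an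
  oscillation allowed by log-Hoelder continuity at scale \<open>R\<close>.
\<close>
lemma powr_oscillation_bound:
  fixes T c M \<omega> L :: real
  assumes "1 \<le> T" "ln T \<le> M * L" "\<bar>\<omega>\<bar> \<le> c / L" "0 < L"
  shows "T powr \<omega> \<le> exp (M * c)" "exp (- (M * c)) \<le> T powr \<omega>"
proof -
  have "\<bar>\<omega> * ln T\<bar> = \<bar>\<omega>\<bar> * ln T" using assms(1) by (simp add: abs_mult)
  also have "\<dots> \<le> (c / L) * (M * L)"
    using assms by (intro mult_mono order_trans[OF abs_ge_zero assms(3)]) auto
  also have "\<dots> = M * c" using \<open>0 < L\<close> by simp
  finally have "\<bar>\<omega> * ln T\<bar> \<le> M * c" .
  then show "T powr \<omega> \<le> exp (M * c)" "exp (- (M * c)) \<le> T powr \<omega>"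
    using assms(1) by (auto simp: powr_def)
qed

lemma sobolev_conj_eq:
  fixes p :: "'a::euclidean_space \<Rightarrow> real"
  assumes "1 \<le> p x" "p x < real DIM('a)"
  shows "sobolev_conj p x = real DIM('a) * p x / (real DIM('a) - p x)"
  using assms by (simp add: sobolev_conj_def field_simps)

lemma sobolev_conj_ge_one:
  fixes p :: "'a::euclidean_space \<Rightarrow> real"
  assumes "1 \<le> p x" "p x < real DIM('a)"
  shows "1 \<le> sobolev_conj p x"
proof -
  have "real DIM('a) * 1 \<le> real DIM('a) * p x" using assms by (intro mult_left_mono) auto
  then have "real DIM('a) - p x \<le> real DIM('a) * p x" using assms by linarith
  then show ?thesis using assms by (simp add: sobolev_conj_eq le_divide_eq)
qed

lemma sobolev_conj_lipschitz:
  fixes p :: "'a::euclidean_space \<Rightarrow> real"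
  assumes "1 \<le> p x" "p x \<le> pmax" "1 \<le> p z" "p z \<le> pmax" "pmax < real DIM('a)"
  shows "\<bar>sobolev_conj p x - sobolev_conj p z\<bar> \<le> (real DIM('a) / (real DIM('a) - pmax))\<^sup>2 * \<bar>p x - p z\<bar>"
proof -
  define n where "n = real DIM('a)"
  have n: "p x < n" "p z < n" "pmax < n" using assms by (auto simp: n_def)
  have "sobolev_conj p x - sobolev_conj p z = (n\<^sup>2 / ((n - p x) * (n - p z))) * (p x - p z)"
  proof -
    have "sobolev_conj p x = n * p x / (n - p x)" "sobolev_conj p z = n * p z / (n - p z)"
      using assms sobolev_conj_eq[of p x] sobolev_conj_eq[of p z] by (auto simp: n_def)
    then have "sobolev_conj p x - sobolev_conj p z
        = (n * p x * (n - p z) - n * p z * (n - p x)) / ((n - p x) * (n - p z))"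
      using n by (simp add: diff_frac_eq)
    also have "n * p x * (n - p z) - n * p z * (n - p x) = n\<^sup>2 * (p x - p z)"
      by (simp add: algebra_simps power2_eq_square)
    finally show ?thesis by simp
  qed
  then have "\<bar>sobolev_conj p x - sobolev_conj p z\<bar> = (n\<^sup>2 / ((n - p x) * (n - p z))) * \<bar>p x - p z\<bar>"
    using n by (simp add: abs_mult)
  also have "\<dots> \<le> (n\<^sup>2 / ((n - pmax) * (n - pmax))) * \<bar>p x - p z\<bar>"
    using assms n by (intro mult_right_mono divide_left_mono mult_mono mult_pos_pos) auto
  finally show ?thesis by (simp add: n_def power_divide power2_eq_square)
qed

lemma log_Hoelder_ball:
  fixes p :: "'a::metric_space \<Rightarrow> real"
  assumes "\<bar>p x - p z\<bar> \<le> c / ln (exp 1 + 1 / dist x z)" "0 \<le> c" "dist z x < R" "R < 1"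
  shows "\<bar>p x - p z\<bar> \<le> c / ln (1 / R)"
proof (cases "x = z")
  case True
  have "0 < R" using assms(3) zero_le_dist[of z x] by linarith
  then show ?thesis using True assms by (auto intro!: divide_nonneg_pos)
next
  case False
  then have d: "0 < dist x z" "dist x z < R" using assms by (auto simp: dist_commute)
  have R: "0 < R" using d by linarith
  have "1 / R \<le> 1 / dist x z"
    using d by (intro frac_le) auto
  then have "1 / R \<le> exp 1 + 1 / dist x z"
    using exp_gt_zero[of "1::real"] by linarith
  then have "ln (1 / R) \<le> ln (exp 1 + 1 / dist x z)" using d R by (subst ln_le_cancel_iff) (auto intro!: add_pos_pos)
  moreover have "0 < ln (1 / R)" using R assms by (intro ln_gt_zero) auto
  ultimately have "c / ln (exp 1 + 1 / dist x z) \<le> c / ln (1 / R)"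
    using assms(2) by (intro divide_left_mono) auto
  then show ?thesis using assms(1) by linarith
qed

section \<open>Thin balls have thinner half balls\<close>

text \<open>
  Let \<open>\<mu> = \<delta> R\<^sup>n L\<^bsup>-\<alpha>\<^esup>\<close> with \<open>L = ln(1/R)\<close> be the threshold for \<open>m(R)\<close>, let \<open>P = p(z)\<close> and \<open>Q = p*(z)\<close>. The level
  \<open>T\<close> in the ball estimate is chosen as \<open>T\<^sup>P = 1 / (B \<mu> L\<^sup>s)\<close>, about the largest value that keeps the Sobolev
  modular below \<open>1\<close>. With \<open>X = R T / C\<close> the estimate becomes \<open>m(R/2) \<le> const X\<^bsup>-Q\<^esup>\<close>, and
  since \<open>Q/P = 1 + Q/n\<close>,

  \<open>X\<^bsup>-Q\<^esup> = B \<mu> L\<^sup>s (B C\<^sup>n \<delta> L\<^bsup>s - \<alpha>\<^esup>)\<^bsup>Q/n\<^esup>\<close>.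

  With \<open>\<alpha> = (n + 1) s\<close> and \<open>Q \<ge> 1\<close> the powers of \<open>L\<close> cancel or help, and what remains is
  \<open>\<mu>\<close> times a positive power of \<open>\<delta>\<close>. A small \<open>\<delta>\<close> therefore beats all constants and also the factor that is
  lost between the thresholds at \<open>R\<close> and at \<open>R/2\<close>.

  The condition \<open>R \<le> \<delta>\<close> ensures \<open>\<mu> \<ge> R\<^sup>N\<close> with an \<open>N\<close> that does not depend on \<open>\<delta>\<close>. All quantities are thus
  powers of \<open>R\<close> up to \<open>\<delta>\<close>-free constants, which is what the oscillation bounds require.
\<close>
lemma density_step:
  fixes \<Omega> :: "'a::euclidean_space set" and p :: "'a \<Rightarrow> real" and \<Phi> :: "'a \<Rightarrow> real \<Rightarrow> real"
  defines "n \<equiv> real DIM('a)"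
  assumes "open \<Omega>"
    and p: "\<And>x. x \<in> \<Omega> \<Longrightarrow> 1 \<le> p x" "\<And>x. x \<in> \<Omega> \<Longrightarrow> p x \<le> pmax" "pmax < n"
    and hoelder: "\<And>x z. x \<in> \<Omega> \<Longrightarrow> z \<in> \<Omega> \<Longrightarrow> \<bar>p x - p z\<bar> \<le> c / ln (exp 1 + 1 / dist x z)" and c: "0 \<le> c"
    and \<Phi>: "AE x in lebesgue_on \<Omega>. \<forall>t\<ge>0. \<Phi> x t \<le> K * t powr p x * ln (exp 1 + t) powr s"
    and K: "1 \<le> K" and s: "0 \<le> s" and C: "1 \<le> C"
    and balls: "\<And>z R T H. 0 < R \<Longrightarrow> R \<le> 1 \<Longrightarrow> 0 < T \<Longrightarrow> 0 \<le> H \<Longrightarrow>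
      (AE x in lebesgue_on \<Omega>. x \<in> ball z R \<longrightarrow> (\<forall>t\<in>{0..T}. \<Phi> x t \<le> H)) \<Longrightarrow>
      H * (n + 1) * measure lebesgue (ball z R \<inter> \<Omega>) \<le> 1 \<Longrightarrow>
      (\<integral>\<^sup>+x\<in>ball z (R / 2). ennreal ((R * T / C) powr sobolev_conj p x) \<partial>lebesgue_on \<Omega>) \<le> 1"
  defines "\<alpha> \<equiv> (n + 1) * s"
  shows "\<exists>\<delta>0>0. \<forall>\<delta> z R. 0 < \<delta> \<longrightarrow> \<delta> \<le> \<delta>0 \<longrightarrow> z \<in> \<Omega> \<longrightarrow> 0 < R \<longrightarrow> R \<le> \<delta> \<longrightarrow> R \<le> exp (-1) \<longrightarrow>
      measure lebesgue (ball z R \<inter> \<Omega>) \<le> \<delta> * R powr n * ln (1 / R) powr (- \<alpha>) \<longrightarrow>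
      measure lebesgue (ball z (R / 2) \<inter> \<Omega>) \<le> \<delta> * (R / 2) powr n * ln (1 / (R / 2)) powr (- \<alpha>)"
proof -
  define N where "N = n + 1 + \<alpha>"
  define c3 where "c3 = (n / (n - pmax))\<^sup>2 * c"
  define B where "B = K * (n + 1) * exp (N * c) * (N + 2) powr s"
  \<comment> \<open>\<open>exp (- E)\<close> will serve as \<open>\<delta>0\<close>; \<open>B\<close> is the constant of the Sobolev modular, \<open>c3\<close> the
    log-Hoelder constant of the conjugate exponent, and \<open>(n + \<alpha>) ln 2\<close> pays for halving the radius.\<close>
  define E where "E = n * (ln B + ln B / n + ln C + N * c3 + (n + \<alpha>) * ln 2)"
  have n: "1 \<le> n" by (simp add: n_def Suc_leI)
  have \<alpha>: "0 \<le> \<alpha>" using n s by (simp add: \<alpha>_def)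
  have N: "1 \<le> N" using n \<alpha> by (simp add: N_def)
  have c3: "0 \<le> c3" using c by (simp add: c3_def)
  have B: "1 \<le> B"
  proof -
    have "1 * 1 * 1 * 1 \<le> B"
      unfolding B_def using K n N c s by (intro mult_mono ge_one_powr_ge_zero) auto
    then show ?thesis by simp
  qed
  have "0 \<le> ln B" "0 \<le> ln C" using B C by auto
  have E_ge: "ln B + n * ln C \<le> E"
  proof -
    have "E = n * ln B + ln B + n * ln C + n * (N * c3 + (n + \<alpha>) * ln 2)"
      using n by (simp add: E_def algebra_simps)
    moreover have "0 \<le> n * (N * c3 + (n + \<alpha>) * ln 2)" "0 \<le> n * ln B"
      using n N c3 \<alpha> \<open>0 \<le> ln B\<close> by (auto intro!: mult_nonneg_nonneg add_nonneg_nonneg)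
    ultimately show ?thesis by linarith
  qed
  have step: "measure lebesgue (ball z (R / 2) \<inter> \<Omega>) \<le> \<delta> * (R / 2) powr n * ln (1 / (R / 2)) powr (- \<alpha>)"
    if \<delta>: "0 < \<delta>" "\<delta> \<le> exp (- E)" and z: "z \<in> \<Omega>" and R: "0 < R" "R \<le> \<delta>" "R \<le> exp (-1)"
      and hyp: "measure lebesgue (ball z R \<inter> \<Omega>) \<le> \<delta> * R powr n * ln (1 / R) powr (- \<alpha>)" for \<delta> z R
  proof -
    define L where "L = ln (1 / R)"
    define \<mu> where "\<mu> = \<delta> * R powr n * L powr (- \<alpha>)"
    define W where "W = B * \<mu> * L powr s"
    define P where "P = p z"
    define Q where "Q = sobolev_conj p z"
    define T where "T = W powr (- 1 / P)"
    define X where "X = R * T / C"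
    have L_eq: "L = - ln R" using R by (simp add: L_def ln_div)
    have "ln R \<le> ln (exp (-1))" using R by (subst ln_le_cancel_iff) auto
    then have L: "1 \<le> L" by (simp add: L_eq)
    have R1: "R < 1" using R(3) exp_less_one_iff[of "-1"] by linarith
    have "ln \<delta> \<le> ln (exp (- E))" using \<delta> by (subst ln_le_cancel_iff) auto
    then have ln\<delta>: "ln \<delta> \<le> - E" by simp
    have "ln R \<le> ln \<delta>" using R \<delta> by (subst ln_le_cancel_iff) auto
    then have ln\<delta>': "- L \<le> ln \<delta>" by (simp add: L_eq)
    have lnL: "0 \<le> ln L" "ln L \<le> L" using L ln_le_minus_one[of L] by auto
    have P: "1 \<le> P" "P < n" using p z by (force simp: P_def)+
    have Q: "1 \<le> Q" unfolding Q_def using P by (intro sobolev_conj_ge_one) (auto simp: P_def n_def)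
    have QP: "Q / P = 1 + Q / n"
      using P n sobolev_conj_eq[of p z] by (simp add: Q_def P_def n_def field_simps)
    have \<mu>: "0 < \<mu>" using \<delta> R L by (simp add: \<mu>_def)
    have W: "0 < W" using \<mu> B L by (simp add: W_def)
    have ln\<mu>: "ln \<mu> = ln \<delta> - n * L - \<alpha> * ln L"
    proof -
      have "\<delta> * R powr n \<noteq> 0" "L powr (- \<alpha>) \<noteq> 0" "R powr n \<noteq> 0" using \<delta> R L by auto
      then show ?thesis using \<delta> R L L_eq by (simp add: \<mu>_def ln_mult ln_powr del: mult_eq_0_iff)
    qed
    have lnW: "ln W = ln B + ln \<mu> + s * ln L"
      using B \<mu> L by (simp add: W_def ln_mult ln_powr)
    have ln\<mu>_ge: "- (N * L) \<le> ln \<mu>"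
    proof -
      have "\<alpha> * ln L \<le> \<alpha> * L" using \<alpha> lnL by (intro mult_left_mono)
      then show ?thesis using ln\<delta>' by (simp add: ln\<mu> N_def algebra_simps)
    qed
    have slnL: "0 \<le> s * ln L" "0 \<le> n * (s * ln L)" using s lnL n by auto
    have \<alpha>lnL: "\<alpha> * ln L = n * (s * ln L) + s * ln L" by (simp add: \<alpha>_def algebra_simps)
    have "0 \<le> n * ln C" "0 \<le> n * L" using n \<open>0 \<le> ln C\<close> L by auto
    then have lnW_le: "ln W \<le> 0" and ln\<mu>_le: "ln \<mu> \<le> 0"
      using lnW ln\<mu> ln\<delta> E_ge slnL \<open>0 \<le> ln B\<close> \<alpha>lnL by linarith+
    have lnW_ge: "- (N * L) \<le> ln W"
      using lnW ln\<mu>_ge slnL \<open>0 \<le> ln B\<close> by linarith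
    have T0: "0 < T" using W by (simp add: T_def)
    have lnT: "ln T = - ln W / P" using W by (simp add: T_def ln_powr)
    have lnT_ge: "0 \<le> ln T" using lnW_le P by (simp add: lnT divide_nonpos_pos)
    have T: "1 \<le> T" using lnT_ge T0 by (simp add: ln_ge_zero_iff)
    have lnT_le: "ln T \<le> N * L"
    proof -
      have "ln T \<le> - ln W / 1" unfolding lnT using lnW_le P by (intro divide_left_mono) auto
      then show ?thesis using lnW_ge by linarith
    qed
    have osc: "\<bar>p x - P\<bar> \<le> c / L" if "x \<in> \<Omega>" "x \<in> ball z R" for x
      unfolding P_def L_def using that z c R1 hoelder by (intro log_Hoelder_ball) auto
    define H where "H = K * (T powr P * exp (N * c)) * ((N + 2) * L) powr s"
    have H0: "0 \<le> H" using K by (simp add: H_def)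
    have H_eq: "H * (n + 1) * \<mu> = 1"
    proof -
      have "T powr P = W powr (- 1)" unfolding T_def powr_powr using P by simp
      also have "\<dots> = 1 / W" using W by (simp add: powr_minus_divide)
      finally have "T powr P = 1 / W" .
      moreover have "((N + 2) * L) powr s = (N + 2) powr s * L powr s"
        using N L by (simp add: powr_mult)
      ultimately have "H * (n + 1) * \<mu> = B * \<mu> * L powr s / W"
        by (simp add: H_def B_def mult_ac)
      then show ?thesis using W unfolding W_def[symmetric] by simp
    qed
    have ln_eT: "ln (exp 1 + T) \<le> (N + 2) * L"
    proof -
      have "exp 1 + T \<le> exp 1 * T + exp 1 * T"
        using T by (intro add_mono) auto
      also have "\<dots> = 2 * exp 1 * T" by simp
      also have "\<dots> \<le> exp 1 * exp 1 * T"
        using T0 exp_ge_add_one_self[of 1] by (intro mult_right_mono) auto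
      finally have "ln (exp 1 + T) \<le> ln (exp 1 * exp 1 * T)"
        using T0 by (subst ln_le_cancel_iff) (auto intro: add_pos_pos)
      also have "\<dots> = 2 + ln T" using T0 by (simp add: ln_mult)
      also have "\<dots> \<le> 2 * L + N * L" using lnT_le L by linarith
      finally show ?thesis by (simp add: algebra_simps)
    qed
    have "AE x in lebesgue_on \<Omega>. x \<in> ball z R \<longrightarrow> (\<forall>t\<in>{0..T}. \<Phi> x t \<le> H)"
      using \<Phi> AE_space
    proof eventually_elim
      case (elim x)
      then have x: "x \<in> \<Omega>" by (simp add: space_restrict_space)
      show ?case
      proof (intro impI ballI)
        fix t assume t: "t \<in> {0..T}" and xb: "x \<in> ball z R"
        have "T powr p x = T powr P * T powr (p x - P)"
          by (simp add: powr_add[symmetric])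
        also have "\<dots> \<le> T powr P * exp (N * c)"
          using powr_oscillation_bound(1)[OF T lnT_le osc[OF x xb]] L by (intro mult_left_mono) auto
        finally have pT: "T powr p x \<le> T powr P * exp (N * c)" .
        have "\<Phi> x t \<le> K * t powr p x * ln (exp 1 + t) powr s" using elim t by auto
        also have "\<dots> \<le> K * (T powr P * exp (N * c)) * ((N + 2) * L) powr s"
        proof (intro mult_mono powr_mono2)
          show "t powr p x \<le> T powr P * exp (N * c)"
            using t p(1)[OF x] by (intro order_trans[OF powr_mono2 pT]) auto
          have "1 \<le> exp 1 + t" using t exp_ge_add_one_self[of 1] by auto
          then show "0 \<le> ln (exp 1 + t)" by simp
          have "ln (exp 1 + t) \<le> ln (exp 1 + T)"
            using t by (subst ln_le_cancel_iff) (auto intro: add_pos_nonneg)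
          then show "ln (exp 1 + t) \<le> (N + 2) * L" using ln_eT by linarith
        qed (use K s in auto)
        finally show "\<Phi> x t \<le> H" by (simp add: H_def)
      qed
    qed
    moreover have "H * (n + 1) * measure lebesgue (ball z R \<inter> \<Omega>) \<le> 1"
    proof -
      have "H * (n + 1) * measure lebesgue (ball z R \<inter> \<Omega>) \<le> H * (n + 1) * \<mu>"
        using hyp H0 n by (intro mult_left_mono) (auto simp: \<mu>_def L_def)
      then show ?thesis using H_eq by simp
    qed
    ultimately have int: "(\<integral>\<^sup>+x\<in>ball z (R / 2). ennreal (X powr sobolev_conj p x) \<partial>lebesgue_on \<Omega>) \<le> 1"
      unfolding X_def using R R1 T0 H0 by (intro balls) auto
    have X0: "0 < X" using R T0 C by (simp add: X_def)
    have lnX: "ln X = ln T - L - ln C"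
      using R T0 C by (simp add: X_def ln_mult ln_div L_eq)
    have lnX_le: "ln X \<le> N * L" using lnX lnT_le L \<open>0 \<le> ln C\<close> by linarith
    define G where "G = N * c3 + (n + \<alpha>) * ln 2"
    have G: "0 \<le> G" using N c3 n \<alpha> by (simp add: G_def)
    \<comment> \<open>The logarithm of the identity for \<open>X\<^bsup>-Q\<^esup>\<close>; it yields \<open>X\<^bsup>Q\<^esup> \<ge> e\<^sup>G / \<mu>\<close>.\<close>
    have QlnX: "G - ln \<mu> \<le> Q * ln X"
    proof -
      define g where "g = ln B + ln \<delta> + n * ln C"
      have g: "g \<le> 0" using E_ge ln\<delta> by (simp add: g_def)
      have "Q * ln X = - (Q / P) * ln W - Q * L - Q * ln C"
        by (simp add: lnX lnT algebra_simps)
      also have "\<dots> = - ln W - (Q / n) * (ln W + n * L + n * ln C)"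
        unfolding QP using n by (simp add: field_simps)
      also have "ln W + n * L + n * ln C = g - n * (s * ln L)"
        by (simp add: lnW ln\<mu> g_def \<alpha>lnL)
      also have "- ln W - (Q / n) * (g - n * (s * ln L)) = - ln W + (Q / n) * (- g) + Q * (s * ln L)"
        using n by (simp add: field_simps)
      finally have eq: "Q * ln X = - ln W + (Q / n) * (- g) + Q * (s * ln L)" .
      have "1 / n * (- g) \<le> (Q / n) * (- g)"
        using Q n g by (intro mult_right_mono divide_right_mono) auto
      moreover have "1 * (s * ln L) \<le> Q * (s * ln L)"
        using Q slnL by (intro mult_right_mono) auto
      ultimately have "- ln \<mu> - ln B - g / n \<le> Q * ln X"
        using eq lnW by simp
      moreover have "G \<le> - ln B - g / n"
      proof -
        have "ln \<delta> / n \<le> - E / n" using ln\<delta> n by (intro divide_right_mono) auto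
        moreover have "E / n = ln B + ln B / n + ln C + G" using n by (simp add: E_def G_def)
        moreover have "g / n = ln B / n + ln \<delta> / n + ln C" using n by (simp add: g_def add_divide_distrib)
        ultimately show ?thesis by simp
      qed
      ultimately show ?thesis by linarith
    qed
    have X: "1 \<le> X"
    proof -
      have "0 \<le> Q * ln X" using QlnX G ln\<mu>_le by linarith
      then have "0 \<le> ln X" using Q by (simp add: zero_le_mult_iff)
      then show ?thesis using X0 by (simp add: ln_ge_zero_iff)
    qed
    define Z where "Z = 2 powr (n + \<alpha>) / \<mu>"
    have Z_le: "Z \<le> X powr sobolev_conj p x" if x: "x \<in> \<Omega>" "x \<in> ball z (R / 2)" for x
    proof -
      have xb: "x \<in> ball z R" using x R by auto
      have "\<bar>sobolev_conj p x - Q\<bar> \<le> (n / (n - pmax))\<^sup>2 * \<bar>p x - P\<bar>"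
        unfolding Q_def P_def n_def using p x z by (intro sobolev_conj_lipschitz) (auto simp: n_def)
      also have "\<dots> \<le> (n / (n - pmax))\<^sup>2 * (c / L)"
        using osc[OF x(1) xb] by (intro mult_left_mono) auto
      finally have "\<bar>sobolev_conj p x - Q\<bar> \<le> c3 / L" by (simp add: c3_def)
      from powr_oscillation_bound(2)[OF X lnX_le this]
      have 1: "exp (- (N * c3)) \<le> X powr (sobolev_conj p x - Q)" using L by simp
      have "exp (G - ln \<mu>) \<le> exp (Q * ln X)" using QlnX by simp
      also have "\<dots> = X powr Q" using X0 by (simp add: powr_def)
      finally have 2: "exp (G - ln \<mu>) \<le> X powr Q" .
      have "Z = exp ((n + \<alpha>) * ln 2 - ln \<mu>)"
        using \<mu> by (simp add: Z_def powr_def exp_diff)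
      also have "\<dots> = exp (G - ln \<mu>) * exp (- (N * c3))"
        by (simp add: G_def exp_add[symmetric])
      also have "\<dots> \<le> X powr Q * X powr (sobolev_conj p x - Q)"
        using 1 2 by (intro mult_mono) auto
      also have "\<dots> = X powr sobolev_conj p x" by (simp add: powr_add[symmetric])
      finally show ?thesis .
    qed
    have Z0: "0 \<le> Z" using \<mu> by (simp add: Z_def)
    have "ennreal (Z * measure lebesgue (ball z (R / 2) \<inter> \<Omega>))
        = (\<integral>\<^sup>+x. ennreal Z * indicator (ball z (R / 2)) x \<partial>lebesgue_on \<Omega>)"
      by (rule nn_integral_const_on_ball[OF \<open>open \<Omega>\<close> Z0, symmetric])
    also have "\<dots> \<le> (\<integral>\<^sup>+x\<in>ball z (R / 2). ennreal (X powr sobolev_conj p x) \<partial>lebesgue_on \<Omega>)"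
      using Z_le by (intro nn_integral_mono) (auto simp: indicator_def space_restrict_space intro!: ennreal_leI)
    also have "\<dots> \<le> 1" by (rule int)
    finally have "Z * measure lebesgue (ball z (R / 2) \<inter> \<Omega>) \<le> 1" by simp
    then have "measure lebesgue (ball z (R / 2) \<inter> \<Omega>) \<le> \<mu> / 2 powr (n + \<alpha>)"
      using \<mu> by (simp add: Z_def field_simps)
    also have "\<dots> = \<delta> * (R / 2) powr n * (2 * L) powr (- \<alpha>)"
      using R L by (simp add: \<mu>_def powr_divide powr_mult powr_add powr_minus_divide)
    also have "\<dots> \<le> \<delta> * (R / 2) powr n * ln (1 / (R / 2)) powr (- \<alpha>)"
    proof (intro mult_left_mono powr_mono2')
      have eq: "ln (1 / (R / 2)) = L + ln 2" using R by (simp add: L_eq ln_div)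
      show "0 < ln (1 / (R / 2))" unfolding eq using L by (intro add_pos_pos) auto
      show "ln (1 / (R / 2)) \<le> 2 * L" unfolding eq using L ln_le_minus_one[of 2] by simp
    qed (use \<alpha> \<delta> in auto)
    finally show ?thesis .
  qed
  show ?thesis
    using step exp_gt_zero[of "- E"] by blast
qed

section \<open>From thin balls to the density conditions\<close>

text \<open>
  Otherwise the step applies repeatedly, and the density at \<open>z\<close> stays below \<open>\<delta>\<close> along the radii
  \<open>R / 2\<^sup>k\<close>. But once such a ball lies in \<open>\<Omega>\<close>, its density is the volume of the unit ball, which exceeds \<open>\<delta>\<close>.
\<close>
lemma density_of_decay_step:
  fixes \<Omega> :: "'a::euclidean_space set"
  defines "n \<equiv> real DIM('a)"
  assumes "open \<Omega>" and \<delta>: "0 < \<delta>" "\<delta> < measure lebesgue (ball (0::'a) 1)" and "0 \<le> \<alpha>"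
    and z: "z \<in> \<Omega>" and R: "0 < R" "R \<le> exp (- 1)"
    and step: "\<And>R'. 0 < R' \<Longrightarrow> R' \<le> R \<Longrightarrow>
      measure lebesgue (ball z R' \<inter> \<Omega>) \<le> \<delta> * R' powr n * ln (1 / R') powr (- \<alpha>) \<Longrightarrow>
      measure lebesgue (ball z (R' / 2) \<inter> \<Omega>) \<le> \<delta> * (R' / 2) powr n * ln (1 / (R' / 2)) powr (- \<alpha>)"
  shows "\<delta> * R powr n * ln (1 / R) powr (- \<alpha>) \<le> measure lebesgue (ball z R \<inter> \<Omega>)"
proof (rule ccontr)
  assume neg: "\<not> ?thesis"
  have R_le: "0 < R / 2 ^ k" "R / 2 ^ k \<le> R" for k
    using R by (auto simp: divide_le_eq)
  have thin: "measure lebesgue (ball z (R / 2 ^ k) \<inter> \<Omega>)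
      \<le> \<delta> * (R / 2 ^ k) powr n * ln (1 / (R / 2 ^ k)) powr (- \<alpha>)" for k
  proof (induction k)
    case 0
    then show ?case using neg by simp
  next
    case (Suc k)
    have "R / 2 ^ Suc k = R / 2 ^ k / 2" by simp
    then show ?case using step[OF R_le(1) R_le(2) Suc] by (simp only:)
  qed
  obtain e where e: "0 < e" "ball z e \<subseteq> \<Omega>"
    using openE[OF \<open>open \<Omega>\<close> z] by blast
  have "(\<lambda>k. R / 2 ^ k) \<longlonglongrightarrow> 0"
  proof -
    have "(\<lambda>k. R * (1 / 2) ^ k) \<longlonglongrightarrow> R * 0"
      by (intro tendsto_mult tendsto_const LIMSEQ_realpow_zero) auto
    then show ?thesis by (simp add: power_one_over)
  qed
  then have "eventually (\<lambda>k. R / 2 ^ k < e) sequentially"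
    using e(1) by (rule order_tendstoD)
  then obtain k where k: "R / 2 ^ k < e" by (auto simp: eventually_sequentially)
  define \<rho> where "\<rho> = R / 2 ^ k"
  have \<rho>: "0 < \<rho>" "\<rho> \<le> exp (- 1)" "\<rho> < e" using R_le[of k] k R by (auto simp: \<rho>_def)
  have "ln \<rho> \<le> ln (exp (- 1))" using \<rho> by (subst ln_le_cancel_iff) auto
  then have L: "1 \<le> ln (1 / \<rho>)" using \<rho> by (simp add: ln_div)
  have "ball z \<rho> \<inter> \<Omega> = ball z \<rho>" using e(2) \<rho>(3) by auto
  then have "measure lebesgue (ball z \<rho>) \<le> \<delta> * \<rho> powr n * ln (1 / \<rho>) powr (- \<alpha>)"
    using thin[of k] by (simp add: \<rho>_def)
  also have "\<dots> \<le> \<delta> * \<rho> powr n * 1"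
    using powr_mono[of "- \<alpha>" 0 "ln (1 / \<rho>)"] L \<open>0 \<le> \<alpha>\<close> \<delta> by (intro mult_left_mono) auto
  also have "\<dots> < measure lebesgue (ball (0::'a) 1) * \<rho> powr n"
    using \<delta> \<rho> by simp
  also have "\<dots> = measure lebesgue (ball z \<rho>)"
    using \<rho> content_ball_conv_unit_ball[of \<rho> z] by (simp add: n_def powr_realpow)
  finally show False by simp
qed

text \<open>
  The ball of radius \<open>R\<close> about \<open>x\<close> contains the ball of radius \<open>R R0\<close> about any \<open>y \<in> \<Omega>\<close> with
  \<open>dist y x < R / 2\<close>. Since \<open>R \<le> 1/2\<close> keeps \<open>ln (1/R)\<close> away from \<open>0\<close>, \<open>ln (1 / (R R0))\<close> is comparable to it.
\<close>
lemma density_on_closure: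
  fixes \<Omega> :: "'a::euclidean_space set"
  assumes "open \<Omega>" and \<delta>: "0 < \<delta>" and \<alpha>: "0 \<le> \<alpha>" and R0: "0 < R0" "R0 \<le> exp (- 1)"
    and inner: "\<And>z R. z \<in> \<Omega> \<Longrightarrow> 0 < R \<Longrightarrow> R \<le> R0 \<Longrightarrow>
      \<delta> * R powr real DIM('a) * ln (1 / R) powr (- \<alpha>) \<le> measure lebesgue (ball z R \<inter> \<Omega>)"
  obtains c where "0 < c" "\<And>x R. x \<in> closure \<Omega> \<Longrightarrow> R \<in> {0<..1/2} \<Longrightarrow>
    c * R ^ DIM('a) * ln (1 / R) powr (- \<alpha>) \<le> measure lebesgue (ball x R \<inter> \<Omega>)"
proof -
  define A where "A = 1 + 2 * ln (1 / R0)"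
  define c where "c = \<delta> * R0 ^ DIM('a) * A powr (- \<alpha>)"
  have "exp (- 1 :: real) \<le> 1 / 2"
    using exp_ge_add_one_self[of 1] by (simp add: exp_minus field_simps)
  then have R0': "R0 \<le> 1 / 2" using R0 by linarith
  have "ln R0 \<le> ln (exp (- 1))" using R0 by (subst ln_le_cancel_iff) auto
  then have lnR0: "1 \<le> ln (1 / R0)" using R0 by (simp add: ln_div)
  then have A: "0 < A" by (simp add: A_def)
  have "c * R ^ DIM('a) * ln (1 / R) powr (- \<alpha>) \<le> measure lebesgue (ball x R \<inter> \<Omega>)"
    if x: "x \<in> closure \<Omega>" and R: "R \<in> {0<..1/2}" for x R
  proof -
    obtain y where y: "y \<in> \<Omega>" "dist y x < R / 2"
      using x R by (meson closure_approachable greaterThanAtMost_iff half_gt_zero)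
    define r where "r = R * R0"
    have r: "0 < r" "r \<le> R0" "r \<le> R / 2"
      using R R0 R0' mult_right_mono[of R 1 R0] mult_left_mono[of R0 "1/2" R] by (auto simp: r_def)
    have "1 / 2 \<le> ln (2 :: real)"
      using ln_le_minus_one[of "1 / 2"] by (simp add: ln_div)
    moreover have "ln 2 \<le> ln (1 / R)"
      using R by (subst ln_le_cancel_iff) (auto simp: field_simps)
    ultimately have L: "1 / 2 \<le> ln (1 / R)" by linarith
    have "ln (1 / r) = ln (1 / R) + 1 * ln (1 / R0)"
      using R R0 by (simp add: r_def ln_div ln_mult)
    also have "\<dots> \<le> ln (1 / R) + (2 * ln (1 / R)) * ln (1 / R0)"
      using L lnR0 by (intro add_left_mono mult_right_mono) auto
    also have "\<dots> = A * ln (1 / R)" by (simp add: A_def algebra_simps)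
    finally have ln_r: "ln (1 / r) \<le> A * ln (1 / R)" .
    have "c * R ^ DIM('a) * ln (1 / R) powr (- \<alpha>) = \<delta> * r powr real DIM('a) * (A * ln (1 / R)) powr (- \<alpha>)"
      using r A L by (simp add: c_def powr_mult powr_realpow r_def power_mult_distrib)
    also have "\<dots> \<le> \<delta> * r powr real DIM('a) * ln (1 / r) powr (- \<alpha>)"
      using \<delta> \<alpha> ln_r r R0' by (intro mult_left_mono powr_mono2') (auto intro!: ln_gt_zero)
    also have "\<dots> \<le> measure lebesgue (ball y r \<inter> \<Omega>)" using y r by (intro inner)
    also have "\<dots> \<le> measure lebesgue (ball x R \<inter> \<Omega>)"
    proof (rule measure_mono_fmeasurable)
      have "dist x w < R" if "dist y w < r" for w
        using dist_triangle[of x w y] that y(2) r(3) by (simp add: dist_commute)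
      then show "ball y r \<inter> \<Omega> \<subseteq> ball x R \<inter> \<Omega>" by auto
      show "ball y r \<inter> \<Omega> \<in> sets lebesgue" using \<open>open \<Omega>\<close> by simp
      show "ball x R \<inter> \<Omega> \<in> lmeasurable"
        using \<open>open \<Omega>\<close> by (intro bounded_set_imp_lmeasurable) (auto intro: bounded_subset[OF bounded_ball])
    qed
    finally show ?thesis .
  qed
  moreover have "0 < c" using \<delta> R0 A by (simp add: c_def)
  ultimately show ?thesis using that by blast
qed

text \<open>
  Both density conditions are instances: \<open>s = 0\<close> gives the plain one and \<open>s > 0\<close> the logarithmic one.
\<close>
lemma density_of_sobolev_embedding:
  fixes \<Omega> :: "'a::euclidean_space set" and p :: "'a \<Rightarrow> real"
  assumes "open \<Omega>" and p1: "\<And>x. x \<in> \<Omega> \<Longrightarrow> 1 \<le> p x"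
    and hoelder: "log_Hoelder_on \<Omega> p"
    and sup: "exponent_sup \<Omega> p < ereal (real DIM('a))"
    and emb: "sobolev_embedding \<Omega> \<Phi> \<Psi>"
    and \<Phi>0: "\<And>x. \<Phi> x 0 = 0"
    and \<Psi>: "\<And>x t. 0 \<le> t \<Longrightarrow> t powr sobolev_conj p x \<le> \<Psi> x t"
    and \<Phi>: "AE x in lebesgue_on \<Omega>. \<forall>t\<ge>0. \<Phi> x t \<le> K * t powr p x * ln (exp 1 + t) powr s"
    and s: "0 \<le> s"
  obtains c where "0 < c" "\<And>x R. x \<in> closure \<Omega> \<Longrightarrow> R \<in> {0<..1/2} \<Longrightarrow>
    c * R ^ DIM('a) * ln (1 / R) powr (- ((real DIM('a) + 1) * s)) \<le> measure lebesgue (ball x R \<inter> \<Omega>)"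
proof (cases "\<Omega> = {}")
  case True
  then show ?thesis using that[of 1] by simp
next
  case False
  let ?n = "real DIM('a)"
  obtain q where "exponent_sup \<Omega> p < ereal q" and q: "q < ?n"
    using ereal_dense2[OF sup] by auto
  have pq: "p x \<le> q" if "x \<in> \<Omega>" for x
  proof -
    have "ereal (p x) \<le> exponent_sup \<Omega> p"
      unfolding exponent_sup_def by (rule SUP_upper[OF that])
    then have "ereal (p x) \<le> ereal q"
      using \<open>exponent_sup \<Omega> p < ereal q\<close> by order
    then show ?thesis by simp
  qed
  obtain c0 where c0: "\<And>x z. x \<in> \<Omega> \<Longrightarrow> z \<in> \<Omega> \<Longrightarrow> \<bar>p x - p z\<bar> \<le> c0 / ln (exp 1 + 1 / dist x z)"
    using hoelder unfolding log_Hoelder_on_def by blast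
  have c0': "\<bar>p x - p z\<bar> \<le> max 0 c0 / ln (exp 1 + 1 / dist x z)" if "x \<in> \<Omega>" "z \<in> \<Omega>" for x z
  proof -
    have "1 \<le> exp 1 + 1 / dist x z"
      using one_le_exp_iff[of "1::real"] zero_le_divide_1_iff[of "dist x z"] zero_le_dist[of x z] by linarith
    then have "c0 / ln (exp 1 + 1 / dist x z) \<le> max 0 c0 / ln (exp 1 + 1 / dist x z)"
      by (intro divide_right_mono) auto
    then show ?thesis using c0[OF that] by linarith
  qed
  have \<Phi>': "AE x in lebesgue_on \<Omega>. \<forall>t\<ge>0. \<Phi> x t \<le> max 1 K * t powr p x * ln (exp 1 + t) powr s"
    using \<Phi>
  proof eventually_elim
    case (elim x)
    show ?case
    proof (intro allI impI)
      fix t :: real assume "0 \<le> t"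
      then have "\<Phi> x t \<le> K * t powr p x * ln (exp 1 + t) powr s" using elim by blast
      also have "\<dots> \<le> max 1 K * t powr p x * ln (exp 1 + t) powr s"
        by (intro mult_right_mono) auto
      finally show "\<Phi> x t \<le> max 1 K * t powr p x * ln (exp 1 + t) powr s" .
    qed
  qed
  have conj: "0 \<le> sobolev_conj p x" if "x \<in> \<Omega>" for x
    using sobolev_conj_ge_one[of p x] p1[OF that] pq[OF that] q by simp
  obtain C where C: "1 \<le> C" and balls: "\<And>z R T H. 0 < R \<Longrightarrow> R \<le> 1 \<Longrightarrow> 0 < T \<Longrightarrow> 0 \<le> H \<Longrightarrow>
      (AE x in lebesgue_on \<Omega>. x \<in> ball z R \<longrightarrow> (\<forall>t\<in>{0..T}. \<Phi> x t \<le> H)) \<Longrightarrow>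
      H * (real DIM('a) + 1) * measure lebesgue (ball z R \<inter> \<Omega>) \<le> 1 \<Longrightarrow>
      (\<integral>\<^sup>+x\<in>ball z (R / 2). ennreal ((R * T / C) powr sobolev_conj p x) \<partial>lebesgue_on \<Omega>) \<le> 1"
    using embedding_on_balls[OF \<open>open \<Omega>\<close> emb \<Phi>0 \<Psi> conj] by blast
  have "\<exists>\<delta>0>0. \<forall>\<delta> z R. 0 < \<delta> \<longrightarrow> \<delta> \<le> \<delta>0 \<longrightarrow> z \<in> \<Omega> \<longrightarrow> 0 < R \<longrightarrow> R \<le> \<delta> \<longrightarrow> R \<le> exp (-1) \<longrightarrow>
      measure lebesgue (ball z R \<inter> \<Omega>) \<le> \<delta> * R powr ?n * ln (1 / R) powr (- ((?n + 1) * s)) \<longrightarrow>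
      measure lebesgue (ball z (R / 2) \<inter> \<Omega>) \<le> \<delta> * (R / 2) powr ?n * ln (1 / (R / 2)) powr (- ((?n + 1) * s))"
    by (rule density_step[where p=p and pmax=q and c="max 0 c0" and \<Phi>=\<Phi> and K="max 1 K" and C=C])
      (fact \<open>open \<Omega>\<close> p1 pq q c0' \<Phi>' s C balls | simp)+
  then obtain \<delta>0 where \<delta>0: "0 < \<delta>0" and step: "\<And>\<delta> z R. 0 < \<delta> \<Longrightarrow> \<delta> \<le> \<delta>0 \<Longrightarrow> z \<in> \<Omega> \<Longrightarrow> 0 < R \<Longrightarrow> R \<le> \<delta> \<Longrightarrow> R \<le> exp (-1) \<Longrightarrow>
      measure lebesgue (ball z R \<inter> \<Omega>) \<le> \<delta> * R powr ?n * ln (1 / R) powr (- ((?n + 1) * s)) \<Longrightarrow>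
      measure lebesgue (ball z (R / 2) \<inter> \<Omega>) \<le> \<delta> * (R / 2) powr ?n * ln (1 / (R / 2)) powr (- ((?n + 1) * s))"
    by blast
  define b where "b = measure lebesgue (ball (0::'a) 1)"
  have b: "0 < b" unfolding b_def by (simp add: content_ball_pos)
  \<comment> \<open>Below the unit ball volume \<open>b\<close>, so that interior points cannot be thin at all small scales.\<close>
  define \<delta> where "\<delta> = min \<delta>0 (b / 2)"
  have \<delta>: "0 < \<delta>" "\<delta> \<le> \<delta>0" "\<delta> < b" using \<delta>0 b by (auto simp: \<delta>_def)
  define R0 where "R0 = min \<delta> (exp (- 1))"
  have R0: "0 < R0" "R0 \<le> exp (- 1)" "R0 \<le> \<delta>" using \<delta> by (auto simp: R0_def)
  have \<alpha>: "0 \<le> (?n + 1) * s" using s by simp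
  have inner: "\<delta> * R powr ?n * ln (1 / R) powr (- ((?n + 1) * s)) \<le> measure lebesgue (ball z R \<inter> \<Omega>)"
    if "z \<in> \<Omega>" "0 < R" "R \<le> R0" for z R
  proof (rule density_of_decay_step[OF \<open>open \<Omega>\<close> \<delta>(1) \<delta>(3)[unfolded b_def] \<alpha> that(1,2)])
    show "R \<le> exp (- 1)" using that R0 by linarith
    show "measure lebesgue (ball z (R' / 2) \<inter> \<Omega>) \<le> \<delta> * (R' / 2) powr ?n * ln (1 / (R' / 2)) powr (- ((?n + 1) * s))"
      if "0 < R'" "R' \<le> R" "measure lebesgue (ball z R' \<inter> \<Omega>) \<le> \<delta> * R' powr ?n * ln (1 / R') powr (- ((?n + 1) * s))" for R'
      using step[OF \<delta>(1,2) \<open>z \<in> \<Omega>\<close> that(1) _ _ that(3)] that(2) \<open>R \<le> R0\<close> R0 by linarith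
  qed
  show ?thesis
    by (rule density_on_closure[OF \<open>open \<Omega>\<close> \<delta>(1) \<alpha> R0(1,2) inner that])
qed

theorem theorem1p3:
  fixes \<Omega> :: "'a::euclidean_space set" and p a r :: "'a \<Rightarrow> real"
  assumes "open \<Omega>"
    and "\<forall>x\<in>closure \<Omega>. 1 \<le> p x"
    and "log_Hoelder_on \<Omega> p"
    and "exponent_sup \<Omega> p < ereal (real DIM('a))"
    and "essentially_bounded_on \<Omega> a"
    and "AE x in lebesgue_on \<Omega>. 0 \<le> a x"
    and "continuous_on \<Omega> r"
    and "bounded (r ` \<Omega>)"
    and "sobolev_embedding \<Omega> (Phi_fun p a r) (Psi_fun p a r)"
  shows "((\<forall>x\<in>\<Omega>. 0 \<le> r x) \<or> ((\<exists>x\<in>\<Omega>. r x < 0) \<and> (\<exists>x\<in>\<Omega>. 0 \<le> r x))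
            \<longrightarrow> log_measure_density \<Omega>)
       \<and> ((\<forall>x\<in>\<Omega>. r x \<le> 0) \<longrightarrow> measure_density \<Omega>)"
proof -
  define \<alpha> where "\<alpha> s = (real DIM('a) + 1) * s" for s
  obtain M where M: "AE x in lebesgue_on \<Omega>. \<bar>a x\<bar> \<le> M"
    using assms(5) by (auto simp: essentially_bounded_on_def)
  have p: "1 \<le> p x" if "x \<in> \<Omega>" for x
    using assms(2) that closure_subset by blast
  have \<Phi>_le: "AE x in lebesgue_on \<Omega>. \<forall>t\<ge>0.
      Phi_fun p a r x t \<le> (1 + M) * t powr p x * ln (exp 1 + t) powr s"
    if s: "0 \<le> s" "\<And>x. x \<in> \<Omega> \<Longrightarrow> r x \<le> s" for s
    using M assms(6) AE_space
  proof eventually_elim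
    case (elim x)
    then have x: "x \<in> \<Omega>" by (simp add: space_restrict_space)
    show ?case
    proof (intro allI impI)
      fix t :: real assume "0 \<le> t"
      then have "exp 1 \<le> exp 1 + t" by simp
      then have "ln (exp 1) \<le> ln (exp 1 + t)" using \<open>0 \<le> t\<close> by (subst ln_le_cancel_iff) (auto intro: add_pos_nonneg)
      then have l: "1 \<le> ln (exp 1 + t)" by simp
      have "Phi_fun p a r x t = t powr p x * (1 + a x * ln (exp 1 + t) powr r x)"
        by (simp add: Phi_fun_def algebra_simps)
      also have "\<dots> \<le> t powr p x * (ln (exp 1 + t) powr s + M * ln (exp 1 + t) powr s)"
        using elim l s s(2)[OF x] by (intro mult_left_mono add_mono mult_mono powr_mono ge_one_powr_ge_zero) auto
      finally show "Phi_fun p a r x t \<le> (1 + M) * t powr p x * ln (exp 1 + t) powr s"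
        by (simp add: algebra_simps)
    qed
  qed
  have \<Psi>_ge: "t powr sobolev_conj p x \<le> Psi_fun p a r x t" for x t
    by (simp add: Psi_fun_def Let_def)
  have density: "\<exists>c>0. \<forall>x\<in>closure \<Omega>. \<forall>R\<in>{0<..1/2}.
      c * R ^ DIM('a) * ln (1 / R) powr (- \<alpha> s) \<le> measure lebesgue (ball x R \<inter> \<Omega>)"
    if s: "0 \<le> s" "\<And>x. x \<in> \<Omega> \<Longrightarrow> r x \<le> s" for s
  proof -
    have "Phi_fun p a r x 0 = 0" for x by (simp add: Phi_fun_def)
    from density_of_sobolev_embedding[OF assms(1) p assms(3,4,9) this \<Psi>_ge \<Phi>_le[OF s] s(1)]
    obtain c where "0 < c" "\<And>x R. x \<in> closure \<Omega> \<Longrightarrow> R \<in> {0<..1/2} \<Longrightarrow>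
        c * R ^ DIM('a) * ln (1 / R) powr (- \<alpha> s) \<le> measure lebesgue (ball x R \<inter> \<Omega>)"
      unfolding \<alpha>_def by blast
    then show ?thesis by blast
  qed
  obtain s where s: "0 < s" "\<And>x. x \<in> \<Omega> \<Longrightarrow> r x \<le> s"
  proof -
    obtain b where "0 < b" "\<And>y. y \<in> r ` \<Omega> \<Longrightarrow> norm y \<le> b"
      using assms(8) by (auto simp: bounded_pos)
    then show ?thesis using that[of b] by force
  qed
  have "log_measure_density \<Omega>"
    unfolding log_measure_density_def
  proof -
    have "0 < \<alpha> s" using s(1) by (auto simp: \<alpha>_def intro!: mult_pos_pos add_nonneg_pos)
    then show "\<exists>c>0. \<exists>\<alpha>>0. \<forall>x\<in>closure \<Omega>. \<forall>R\<in>{0<..1/2}.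
        c * R ^ DIM('a) * ln (1 / R) powr (- \<alpha>) \<le> measure lebesgue (ball x R \<inter> \<Omega>)"
      using density[OF less_imp_le[OF s(1)] s(2)] by blast
  qed
  moreover have "measure_density \<Omega>" if "\<forall>x\<in>\<Omega>. r x \<le> 0"
  proof -
    have "ln (1 / R) powr (- \<alpha> 0) = 1" if "R \<in> {0<..1/2}" for R :: real
      using that by (auto simp: \<alpha>_def)
    then show ?thesis
      unfolding measure_density_def using density[of 0] that by auto
  qed
  ultimately show ?thesis by blast
qed

end
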